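(* There exists a polynomial $P$ with nonnegative coefficients (universal, i.e. not depending on the problem instance or on $T$) such that the following holds. Let $T\ge 1$. Consider the constrained online convex optimization problem described in the context, satisfying the boundedness/smoothness assumptions, Slater's condition with constant $\varsigma>0$, and $D(\mathbf x,\mathbf y)\le R^2$ for all $\mathbf x,\mathbf y\in\mathcal X_0$. Run the online primal-dual mirror-prox algorithm of the context with $$\eta=[V_*(T)+L_f^2+1]^{-1/2},\qquad \gamma=[V_*(T)+L_f^2+1]^{1/4},$$ $$\alpha_0=0,\qquad \alpha_t=\max\Big\{\tfrac{2}{\rho}\big(\gamma^2L_gG+\eta L_f^2+\eta^{-1}+\xi_t\big),\ \alpha_{t-1}\Big\}\quad(t\ge1),$$ where $\xi_t=\gamma L_g\|\mathbf Q(t)\|_1+\gamma^2(L_gG+H^2)$. Then for every $k\in[K]$, $$\mathrm{Violation}(T,k):=\sum_{t=1}^Tg_k(\mathbf x_t)\le P(R,H,F,G,L_f,L_g,K,\rho,1/\rho)\,(1+\varsigma^{-1}).$$ In particular, the constraint violation is bounded by a constant independent of $T$.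
   Context: Notation. $d,K\ge1$ are integers; $\|\cdot\|$ is a norm on $\mathbb R^d$ with dual norm $\|\mathbf x\|_*=\sup_{\|\mathbf y\|\le1}\langle\mathbf x,\mathbf y\rangle$; $[K]=\{1,\dots,K\}$. Problem. $\mathcal X_0\subset\mathbb R^d$ is a nonempty convex compact set. The losses $f^t:\mathcal X_0\to\mathbb R$, $t=0,1,2,\dots$, are convex and differentiable ($f^t$ is revealed after $\mathbf x_t$ is chosen; $f^0$ is used only for initialization). The constraint functions $g_k$, $k\in[K]$, are convex and differentiable on $\mathcal X_0$; $\mathbf g(\mathbf x)=[g_1(\mathbf x),\dots,g_K(\mathbf x)]^\top$. $$V_*(T)=\sum_{t=1}^T\max_{\mathbf x\in\mathcal X_0}\|\nabla f^t(\mathbf x)-\nabla f^{t-1}(\mathbf x)\|_*^2.$$ Boundedness/smoothness assumptions. For all $\mathbf x,\mathbf y\in\mathcal X_0$, $t\ge0$, $k\in[K]$: $\|\nabla f^t(\mathbf x)\|_*\le F$; $\|\nabla f^t(\mathbf x)-\nabla f^t(\mathbf y)\|_*\le L_f\|\mathbf x-\mathbf y\|$; $\sum_{k=1}^K|g_k(\mathbf x)|\le G$; $|g_k(\mathbf x)-g_k(\mathbf y)|\le H_k\|\mathbf x-\mathbf y\|$, with $H:=\sum_{k=1}^KH_k$; $\|\nabla g_k(\mathbf x)-\nabla g_k(\mathbf y)\|_*\le L_g\|\mathbf x-\mathbf y\|$. Slater's condition. There are $\varsigma>0$ and $\breve{\mathbf x}\in\mathcal X_0$ with $g_k(\breve{\mathbf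 x})\le-\varsigma$ for all $k\in[K]$. Bregman divergence. $\omega:\mathcal X_0\to\mathbb R$ is strictly convex, continuously differentiable in the interior of $\mathcal X_0$, and $\rho$-strongly convex w.r.t. $\|\cdot\|$ for some $\rho>0$: $\langle\mathbf x-\mathbf y,\nabla\omega(\mathbf x)-\nabla\omega(\mathbf y)\rangle\ge\rho\|\mathbf x-\mathbf y\|^2$. $D(\mathbf x,\mathbf y)=\omega(\mathbf x)-\omega(\mathbf y)-\langle\nabla\omega(\mathbf y),\mathbf x-\mathbf y\rangle$, taken to be well defined for all $\mathbf x,\mathbf y\in\mathcal X_0$; it satisfies $D(\mathbf x,\mathbf y)\ge\frac\rho2\|\mathbf x-\mathbf y\|^2$. Online primal-dual mirror-prox algorithm (parameters $\gamma>0$, $\alpha_t>0$). Initialize arbitrary $\mathbf x_0,\tilde{\mathbf x}_1\in\mathcal X_0$ and $Q_k(0)=0$, $k\in[K]$. For $t=1,2,\dots$: (1) $Q_k(t)=\max\{-\gamma g_k(\mathbf x_{t-1}),\ Q_k(t-1)+\gamma g_k(\mathbf x_{t-1})\}$ for $k\in[K]$, and $\mathbf Q(t)=[Q_1(t),\dots,Q_K(t)]^\top$; (2) $\mathbf x_t=\arg\min_{\mathbf x\in\mathcal X_0}\langle\nabla f^{t-1}(\mathbf x_{t-1}),\mathbf x\rangle+\sum_{k=1}^K[Q_k(t)+\gamma g_k(\mathbf x_{t-1})]\langle\gamma\nabla g_k(\mathbf x_{t-1}),\mathbf x\rangle+\alpha_tD(\mathbf x,\tilde{\mathbf x}_t)$;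 (3) play $\mathbf x_t$, observe $f^t$; (4) $\tilde{\mathbf x}_{t+1}=\arg\min_{\mathbf x\in\mathcal X_0}\langle\nabla f^t(\mathbf x_t),\mathbf x\rangle+\sum_{k=1}^K[Q_k(t)+\gamma g_k(\mathbf x_{t-1})]\langle\gamma\nabla g_k(\mathbf x_{t-1}),\mathbf x\rangle+\alpha_tD(\mathbf x,\tilde{\mathbf x}_t)$. *)

theory Defs
  imports "HOL-Analysis.Analysis" "HOL-Analysis.Finite_Function_Topology"
begin

section \<open>Euclidean space with the dimension as a natural number\<close>

text \<open>
  The polynomial in the theorem must not depend on the dimension, so the dimension has to be
  quantified inside an existential statement and cannot be a type. We therefore realise
  \<open>\<real>\<^sup>d\<close> as the subspace of the finitely supported real sequences that
  vanish from index \<open>d\<close> on. The library makes these sequences a normed space (with the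
  l1 norm); as all norms on \<open>\<real>\<^sup>d\<close> are equivalent, compactness, continuity and
  differentiability of the library are the usual ones on this subspace.
\<close>

type_synonym rvec = "nat \<Rightarrow>\<^sub>0 real"

definition Rd :: "nat \<Rightarrow> rvec set" where
  "Rd d = {x. Poly_Mapping.keys x \<subseteq> {..<d}}"

definition dotp :: "nat \<Rightarrow> rvec \<Rightarrow> rvec \<Rightarrow> real" where
  "dotp d x y = (\<Sum>i<d. Poly_Mapping.lookup x i * Poly_Mapping.lookup y i)"

definition is_norm_on :: "nat \<Rightarrow> (rvec \<Rightarrow> real) \<Rightarrow> bool" where
  "is_norm_on d N \<longleftrightarrow>
     (\<forall>x\<in>Rd d. 0 \<le> N x \<and> (N x = 0 \<longleftrightarrow> x = 0)) \<and>
     (\<forall>x\<in>Rd d. \<forall>a. N (a *\<^sub>R x) = \<bar>a\<bar> * N x) \<and>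
     (\<forall>x\<in>Rd d. \<forall>y\<in>Rd d. N (x + y) \<le> N x + N y)"

definition dual_norm :: "nat \<Rightarrow> (rvec \<Rightarrow> real) \<Rightarrow> rvec \<Rightarrow> real" where
  "dual_norm d N x = (SUP y\<in>{y \<in> Rd d. N y \<le> 1}. dotp d x y)"

text \<open>
  Functions on \<open>X\<close> are differentiated within \<open>X\<close>, so nothing is required of
  values outside \<open>X\<close>. If \<open>X\<close> has empty interior in \<open>\<real>\<^sup>d\<close> the
  gradient is not unique; gradients are hence passed around as explicit maps, and statements hold
  for any choice of them.
\<close>

definition has_gradient_within ::
    "nat \<Rightarrow> (rvec \<Rightarrow> real) \<Rightarrow> rvec \<Rightarrow> rvec \<Rightarrow> rvec set \<Rightarrow> bool" where
  "has_gradient_within d h v x X \<longleftrightarrow>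
     v \<in> Rd d \<and> (h has_derivative dotp d v) (at x within X)"

definition strictly_convex_on :: "'a::real_vector set \<Rightarrow> ('a \<Rightarrow> real) \<Rightarrow> bool" where
  "strictly_convex_on X h \<longleftrightarrow> convex X \<and>
     (\<forall>x\<in>X. \<forall>y\<in>X. \<forall>u. x \<noteq> y \<and> 0 < u \<and> u < 1 \<longrightarrow>
        h ((1 - u) *\<^sub>R x + u *\<^sub>R y) < (1 - u) * h x + u * h y)"

section \<open>The constrained online problem\<close>

text \<open>
  \<open>gf t\<close> and \<open>gg k\<close> are the gradient maps of the loss \<open>f t\<close> and of the
  constraint function \<open>g k\<close>.
\<close>

locale online_problem =
  fixes d K :: nat and N :: "rvec \<Rightarrow> real" and X :: "rvec set"
    and f :: "nat \<Rightarrow> rvec \<Rightarrow> real" and gf :: "nat \<Rightarrow> rvec \<Rightarrow> rvec"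
    and g :: "nat \<Rightarrow> rvec \<Rightarrow> real" and gg :: "nat \<Rightarrow> rvec \<Rightarrow> rvec"
  assumes dim_pos: "1 \<le> d" and num_constraints_pos: "1 \<le> K"
    and norm_N: "is_norm_on d N"
    and X_sub: "X \<subseteq> Rd d" and X_nonempty: "X \<noteq> {}"
    and X_convex: "convex X" and X_compact: "compact X"
    and f_convex: "\<And>t. convex_on X (f t)"
    and f_grad: "\<And>t x. x \<in> X \<Longrightarrow> has_gradient_within d (f t) (gf t x) x X"
    and g_convex: "\<And>k. k \<in> {1..K} \<Longrightarrow> convex_on X (g k)"
    and g_grad: "\<And>k x. k \<in> {1..K} \<Longrightarrow> x \<in> X \<Longrightarrow>
                   has_gradient_within d (g k) (gg k x) x X"

text \<open>
  Nonnegativity of \<open>F\<close> and \<open>G\<close> follows from the bounds. That of the Lipschitz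
  constants follows too unless \<open>X\<close> is a single point, where the Lipschitz conditions
  would admit negative constants.
\<close>

locale bounded_online_problem = online_problem d K N X f gf g gg
  for d K :: nat and N :: "rvec \<Rightarrow> real" and X :: "rvec set"
    and f :: "nat \<Rightarrow> rvec \<Rightarrow> real" and gf :: "nat \<Rightarrow> rvec \<Rightarrow> rvec"
    and g :: "nat \<Rightarrow> rvec \<Rightarrow> real" and gg :: "nat \<Rightarrow> rvec \<Rightarrow> rvec" +
  fixes F Lf G :: real and H :: "nat \<Rightarrow> real" and Lg :: real
  assumes Lf_nonneg: "0 \<le> Lf" and Lg_nonneg: "0 \<le> Lg"
    and H_nonneg: "\<And>k. k \<in> {1..K} \<Longrightarrow> 0 \<le> H k"
    and f_grad_bound: "\<And>t x. x \<in> X \<Longrightarrow> dual_norm d N (gf t x) \<le> F"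
    and f_smooth: "\<And>t x y. x \<in> X \<Longrightarrow> y \<in> X \<Longrightarrow>
                     dual_norm d N (gf t x - gf t y) \<le> Lf * N (x - y)"
    and g_bound: "\<And>x. x \<in> X \<Longrightarrow> (\<Sum>k=1..K. \<bar>g k x\<bar>) \<le> G"
    and g_Lipschitz: "\<And>k x y. k \<in> {1..K} \<Longrightarrow> x \<in> X \<Longrightarrow> y \<in> X \<Longrightarrow>
                        \<bar>g k x - g k y\<bar> \<le> H k * N (x - y)"
    and g_smooth: "\<And>k x y. k \<in> {1..K} \<Longrightarrow> x \<in> X \<Longrightarrow> y \<in> X \<Longrightarrow>
                     dual_norm d N (gg k x - gg k y) \<le> Lg * N (x - y)"

definition slater :: "nat \<Rightarrow> rvec set \<Rightarrow> (nat \<Rightarrow> rvec \<Rightarrow> real) \<Rightarrow> real \<Rightarrow> bool" where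
  "slater K X g \<sigma> \<longleftrightarrow> 0 < \<sigma> \<and> (\<exists>z\<in>X. \<forall>k\<in>{1..K}. g k z \<le> - \<sigma>)"

text \<open>
  The supremum is a maximum for the problems above: \<open>X\<close> is compact and the gradient maps
  are Lipschitz.
\<close>

definition gradient_variation ::
    "nat \<Rightarrow> (rvec \<Rightarrow> real) \<Rightarrow> rvec set \<Rightarrow> (nat \<Rightarrow> rvec \<Rightarrow> rvec) \<Rightarrow> nat \<Rightarrow> real" where
  "gradient_variation d N X gf T =
     (\<Sum>t=1..T. SUP x\<in>X. (dual_norm d N (gf t x - gf (t - 1) x))\<^sup>2)"

section \<open>Bregman divergence\<close>

definition bregman ::
    "nat \<Rightarrow> (rvec \<Rightarrow> real) \<Rightarrow> (rvec \<Rightarrow> rvec) \<Rightarrow> rvec \<Rightarrow> rvec \<Rightarrow> real" where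
  "bregman d \<omega> g\<omega> x y = \<omega> x - \<omega> y - dotp d (g\<omega> y) (x - y)"

text \<open>
  The divergence being well defined on all of \<open>X\<close> means that \<open>\<omega>\<close> has a
  gradient at every point of \<open>X\<close>. The interior is taken in \<open>\<real>\<^sup>d\<close>, not in
  the ambient sequence space. The lower bound of the divergence by \<open>\<rho>/2\<close> times the
  squared norm is a consequence of these conditions.
\<close>

locale mirror_map =
  fixes d :: nat and N :: "rvec \<Rightarrow> real" and X :: "rvec set"
    and \<omega> :: "rvec \<Rightarrow> real" and g\<omega> :: "rvec \<Rightarrow> rvec" and \<rho> :: real
  assumes \<rho>_pos: "0 < \<rho>"
    and \<omega>_strictly_convex: "strictly_convex_on X \<omega>"
    and \<omega>_grad: "\<And>x. x \<in> X \<Longrightarrow> has_gradient_within d \<omega> (g\<omega> x) x X"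
    and \<omega>_C1: "continuous_on (top_of_set (Rd d) interior_of X) g\<omega>"
    and \<omega>_strongly_convex: "\<And>x y. x \<in> X \<Longrightarrow> y \<in> X \<Longrightarrow>
          \<rho> * (N (x - y))\<^sup>2 \<le> dotp d (x - y) (g\<omega> x - g\<omega> y)"

section \<open>Online primal-dual mirror-prox algorithm\<close>

text \<open>
  The common objective of both updates, as a function of \<open>y\<close>: \<open>v\<close> is the loss
  gradient in use, \<open>p\<close> the previous iterate, \<open>q k\<close> the current dual variable
  and \<open>z\<close> the proximal centre.
\<close>

definition prox_objective ::
    "nat \<Rightarrow> nat \<Rightarrow> (nat \<Rightarrow> rvec \<Rightarrow> real) \<Rightarrow> (nat \<Rightarrow> rvec \<Rightarrow> rvec) \<Rightarrow>
     (rvec \<Rightarrow> real) \<Rightarrow> (rvec \<Rightarrow> rvec) \<Rightarrow> real \<Rightarrow> real \<Rightarrow>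
     rvec \<Rightarrow> (nat \<Rightarrow> real) \<Rightarrow> rvec \<Rightarrow> rvec \<Rightarrow> rvec \<Rightarrow> real" where
  "prox_objective d K g gg \<omega> g\<omega> \<gamma> a v q p z y =
     dotp d v y + (\<Sum>k=1..K. (q k + \<gamma> * g k p) * dotp d (\<gamma> *\<^sub>R gg k p) y) +
     a * bregman d \<omega> g\<omega> y z"

text \<open>
  A run of the algorithm: \<open>x t\<close> are the played points, \<open>w t\<close> the auxiliary
  points (with a tilde in the literature), \<open>Q t k\<close> the dual variables.
\<close>

locale mirror_prox_run =
  fixes d K :: nat and X :: "rvec set" and gf :: "nat \<Rightarrow> rvec \<Rightarrow> rvec"
    and g :: "nat \<Rightarrow> rvec \<Rightarrow> real" and gg :: "nat \<Rightarrow> rvec \<Rightarrow> rvec"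
    and \<omega> :: "rvec \<Rightarrow> real" and g\<omega> :: "rvec \<Rightarrow> rvec"
    and \<gamma> :: real and \<alpha> :: "nat \<Rightarrow> real"
    and x w :: "nat \<Rightarrow> rvec" and Q :: "nat \<Rightarrow> nat \<Rightarrow> real"
  assumes \<gamma>_pos: "0 < \<gamma>" and \<alpha>_pos: "\<And>t. 1 \<le> t \<Longrightarrow> 0 < \<alpha> t"
    and init_x: "x 0 \<in> X" and init_w: "w 1 \<in> X"
    and init_Q: "\<And>k. k \<in> {1..K} \<Longrightarrow> Q 0 k = 0"
    and step_Q: "\<And>t k. 1 \<le> t \<Longrightarrow> k \<in> {1..K} \<Longrightarrow>
          Q t k = max (- \<gamma> * g k (x (t - 1))) (Q (t - 1) k + \<gamma> * g k (x (t - 1)))"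
    and step_x: "\<And>t. 1 \<le> t \<Longrightarrow>
          is_arg_min
            (prox_objective d K g gg \<omega> g\<omega> \<gamma> (\<alpha> t) (gf (t - 1) (x (t - 1))) (Q t) (x (t - 1)) (w t))
            (\<lambda>y. y \<in> X) (x t)"
    and step_w: "\<And>t. 1 \<le> t \<Longrightarrow>
          is_arg_min
            (prox_objective d K g gg \<omega> g\<omega> \<gamma> (\<alpha> t) (gf t (x t)) (Q t) (x (t - 1)) (w t))
            (\<lambda>y. y \<in> X) (w (t + 1))"

definition violation ::
    "(nat \<Rightarrow> rvec \<Rightarrow> real) \<Rightarrow> (nat \<Rightarrow> rvec) \<Rightarrow> nat \<Rightarrow> nat \<Rightarrow> real" where
  "violation g x T k = (\<Sum>t=1..T. g k (x t))"

section \<open>Multivariate polynomials\<close>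

text \<open>
  A finitely supported map from exponent vectors to coefficients; \<open>Poly_Mapping.lookup m i\<close>
  is the exponent of the \<open>i\<close>-th variable in the monomial \<open>m\<close>.
\<close>

type_synonym mpoly_real = "(nat \<Rightarrow>\<^sub>0 nat) \<Rightarrow>\<^sub>0 real"

definition nonneg_mpoly_in :: "nat \<Rightarrow> mpoly_real \<Rightarrow> bool" where
  "nonneg_mpoly_in n P \<longleftrightarrow>
     (\<forall>m\<in>Poly_Mapping.keys P. Poly_Mapping.keys m \<subseteq> {..<n} \<and> 0 \<le> Poly_Mapping.lookup P m)"

definition mpoly_eval :: "mpoly_real \<Rightarrow> real list \<Rightarrow> real" where
  "mpoly_eval P vs = (\<Sum>m\<in>Poly_Mapping.keys P.
     Poly_Mapping.lookup P m * (\<Prod>i<length vs. (vs ! i) ^ Poly_Mapping.lookup m i))"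

end

theory Submission
  imports Defs
begin

text \<open>
  The dual variables accumulate the violation: \<open>Q (t + 1) k \<ge> Q t k + \<gamma> * g k (x t)\<close>, so
  \<open>\<gamma>\<close> times the violation after \<open>T\<close> rounds is at most \<open>Q (T + 1) k\<close>, and it suffices that
  the dual variables never exceed \<open>\<gamma>\<close> times a constant. Their squared length may hence reach the
  order \<open>\<gamma>\<^sup>2\<close>, which is at least the square root of the gradient variation.

  The squared length of the dual vector is estimated by a drift argument. One round changes half of
  it by at most a multiplier-weighted sum of the \<open>g k (x t)\<close> plus second-order terms
  (\<open>drift\<close>). Linearising the constraints at the previous iterate and comparing with a Slater
  point \<open>z\<close> by means of the optimality conditions of the two proximal steps
  (\<open>linearised_constraints\<close>, \<open>mirror_prox_step\<close>) replaces this sum by the negative drift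
  \<open>- \<sigma> * \<gamma> * Q1 t\<close>, where \<open>Q1 t\<close> is the l1 norm of the dual vector, plus
  terms of order \<open>\<gamma>\<^sup>2\<close> and differences of Bregman divergences. The step sizes \<open>\<alpha> t\<close> are just large
  enough for the strong convexity of the mirror map to absorb all quadratic terms in the movement of
  the iterates: of the movement from \<open>x (t - 1)\<close> over \<open>w t\<close> to \<open>x t\<close>, the second part is paid by
  a divergence of the current round and the first part by one left over from the previous round. What
  remains of the changes of the loss gradients is bounded by \<open>\<eta>\<close> times the gradient variation,
  which is at most \<open>\<gamma>\<^sup>2\<close>. All this is recorded as one inequality for a potential \<open>\<Phi>\<close> (\<open>potential_step\<close>).

  By this inequality \<open>\<Phi>\<close> only grows through the variation terms while \<open>Q1 t\<close> exceeds a threshold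
  \<open>\<theta>\<close> of order \<open>\<gamma>\<close>; and right after a round where \<open>Q1 t\<close> is below the threshold, \<open>\<Phi>\<close> is
  bounded outright (\<open>potential_bound\<close>). The resulting bound on the dual vector contains the step
  sizes, which themselves depend on the dual vector, but only linearly with factor \<open>\<gamma>\<close>. Taking
  the largest dual vector of the run, of Euclidean length \<open>\<gamma> * m\<close>, and dividing by \<open>\<gamma>\<^sup>2\<close>, the estimate
  becomes a quadratic inequality \<open>m\<^sup>2 \<le> a\<^sup>2 + b + c * m\<close> whose coefficients are
  polynomials in the problem data, \<open>1 / \<rho>\<close> and \<open>1 / \<sigma>\<close>; hence \<open>m \<le> a + b + c\<close> (\<open>Q_le\<close>).
\<close>

section \<open>Norms and dual norms on coordinate space\<close>

lemma lookup_scaleR [simp]: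
  "Poly_Mapping.lookup (a *\<^sub>R x) i = a *\<^sub>R Poly_Mapping.lookup x i"
proof -
  have "finite {i. a *\<^sub>R Poly_Mapping.lookup x i \<noteq> 0}"
    by (rule finite_subset[OF _ finite_keys[of x]]) (auto simp: in_keys_iff)
  then show ?thesis
    by (simp add: scaleR_poly_mapping_def)
qed

lemma in_Rd_iff: "x \<in> Rd d \<longleftrightarrow> (\<forall>i\<ge>d. Poly_Mapping.lookup x i = 0)"
  unfolding Rd_def subset_iff in_keys_iff lessThan_iff mem_Collect_eq by (metis not_less)

lemma Rd_zero [simp]: "0 \<in> Rd d"
  and Rd_add: "x \<in> Rd d \<Longrightarrow> y \<in> Rd d \<Longrightarrow> x + y \<in> Rd d"
  and Rd_diff: "x \<in> Rd d \<Longrightarrow> y \<in> Rd d \<Longrightarrow> x - y \<in> Rd d"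
  and Rd_scaleR: "x \<in> Rd d \<Longrightarrow> a *\<^sub>R x \<in> Rd d"
  by (auto simp: in_Rd_iff lookup_add lookup_minus)

lemma dotp_add_right: "dotp d u (x + y) = dotp d u x + dotp d u y"
  and dotp_diff_right: "dotp d u (x - y) = dotp d u x - dotp d u y"
  and dotp_scaleR_right: "dotp d u (a *\<^sub>R x) = a * dotp d u x"
  by (simp_all add: dotp_def lookup_add lookup_minus sum.distrib sum_subtractf
      sum_distrib_left algebra_simps)

lemma dotp_sum_left: "dotp d (\<Sum>i\<in>A. u i) y = (\<Sum>i\<in>A. dotp d (u i) y)"
  by (simp add: dotp_def lookup_sum sum_distrib_right sum.swap[of _ _ A])

lemma dotp_commute: "dotp d x y = dotp d y x"
  by (simp add: dotp_def mult.commute)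

lemma dotp_add_left: "dotp d (x + y) u = dotp d x u + dotp d y u"
  and dotp_diff_left: "dotp d (x - y) u = dotp d x u - dotp d y u"
  and dotp_scaleR_left: "dotp d (a *\<^sub>R x) u = a * dotp d x u"
  using dotp_add_right dotp_diff_right dotp_scaleR_right dotp_commute by metis+

lemma norm_Rd:
  assumes "x \<in> Rd d"
  shows "norm x = (\<Sum>i<d. \<bar>Poly_Mapping.lookup x i\<bar>)"
proof -
  have "norm x = (\<Sum>i\<in>Poly_Mapping.keys x. \<bar>Poly_Mapping.lookup x i\<bar>)"
    by (simp add: norm_poly_mapping_def dist_poly_mapping_def)
  also have "\<dots> = (\<Sum>i<d. \<bar>Poly_Mapping.lookup x i\<bar>)"
    using assms by (intro sum.mono_neutral_left) (auto simp: Rd_def in_keys_iff)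
  finally show ?thesis .
qed

text \<open>
  The space of finite sequences is infinite-dimensional, so compactness cannot be read off from
  boundedness. The cube is built up one coordinate at a time as a continuous image of a product.
\<close>

lemma compact_unit_cube:
  "compact {x \<in> Rd d. \<forall>i. \<bar>Poly_Mapping.lookup x i\<bar> \<le> 1}" (is "compact (?C d)")
proof (induction d)
  case 0
  have "?C 0 = {0}"
    by (auto simp: in_Rd_iff intro: poly_mapping_eqI)
  then show ?case by simp
next
  case (Suc d)
  let ?e = "Poly_Mapping.single d (1::real)"
  let ?h = "\<lambda>p. fst p + snd p *\<^sub>R ?e"
  have "?C (Suc d) = ?h ` (?C d \<times> {-1..1})"
  proof (intro equalityI subsetI)
    fix x assume x: "x \<in> ?C (Suc d)"
    let ?y = "x - Poly_Mapping.lookup x d *\<^sub>R ?e"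
    have "?y \<in> ?C d"
      using x by (auto simp: in_Rd_iff lookup_minus lookup_single when_def Suc_le_eq)
    moreover have "Poly_Mapping.lookup x d \<in> {-1..1}"
      using x by (auto simp: abs_le_iff minus_le_iff)
    ultimately show "x \<in> ?h ` (?C d \<times> {-1..1})"
      by (intro image_eqI[of _ _ "(?y, Poly_Mapping.lookup x d)"]) auto
  next
    fix x assume "x \<in> ?h ` (?C d \<times> {-1..1})"
    then show "x \<in> ?C (Suc d)"
      by (auto simp: in_Rd_iff lookup_add lookup_single when_def)
  qed
  moreover have "compact (?h ` (?C d \<times> {-1..1}))"
    by (intro compact_continuous_image continuous_intros compact_Times Suc) auto
  ultimately show ?case by simp
qed

lemma norm_onD:
  assumes "is_norm_on d N"
  shows "N 0 = 0"
    and "x \<in> Rd d \<Longrightarrow> 0 \<le> N x"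
    and "x \<in> Rd d \<Longrightarrow> x \<noteq> 0 \<Longrightarrow> 0 < N x"
    and "x \<in> Rd d \<Longrightarrow> N (a *\<^sub>R x) = \<bar>a\<bar> * N x"
    and "x \<in> Rd d \<Longrightarrow> y \<in> Rd d \<Longrightarrow> N (x + y) \<le> N x + N y"
  using assms Rd_zero[of d] unfolding is_norm_on_def by (auto simp: order.strict_iff_order)

lemma norm_on_minus_commute:
  assumes "is_norm_on d N" "x \<in> Rd d" "y \<in> Rd d"
  shows "N (x - y) = N (y - x)"
  using norm_onD(4)[OF assms(1) Rd_diff[OF assms(2,3)], of "-1"] by simp

lemma norm_on_sum_le:
  assumes N: "is_norm_on d N" and fin: "finite A" and A: "\<And>i. i \<in> A \<Longrightarrow> y i \<in> Rd d"
  shows "(\<Sum>i\<in>A. y i) \<in> Rd d \<and> N (\<Sum>i\<in>A. y i) \<le> (\<Sum>i\<in>A. N (y i))"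
  using fin A
proof (induction A rule: finite_induct)
  case empty
  then show ?case using norm_onD(1)[OF N] by simp
next
  case (insert i A)
  then have y: "y i \<in> Rd d" and s: "sum y A \<in> Rd d" "N (sum y A) \<le> (\<Sum>i\<in>A. N (y i))"
    by auto
  have "N (y i + sum y A) \<le> N (y i) + N (sum y A)"
    using norm_onD(5)[OF N] y s by simp
  with s y insert show ?case by (simp add: Rd_add)
qed

lemma norm_on_le_norm:
  assumes N: "is_norm_on d N"
  obtains C where "0 \<le> C" "\<And>x. x \<in> Rd d \<Longrightarrow> N x \<le> C * norm x"
proof
  define C where "C = (\<Sum>i<d. N (Poly_Mapping.single i 1))"
  have e: "Poly_Mapping.single i 1 \<in> Rd d" if "i < d" for i
    using that by (simp add: Rd_def)
  have Ne: "0 \<le> N (Poly_Mapping.single i 1)" if "i < d" for i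
    using norm_onD(2)[OF N e[OF that]] .
  show "0 \<le> C"
    unfolding C_def using Ne by (intro sum_nonneg) auto
  fix x assume x: "x \<in> Rd d"
  let ?y = "\<lambda>i. Poly_Mapping.lookup x i *\<^sub>R Poly_Mapping.single i (1::real)"
  have "x = (\<Sum>i<d. ?y i)"
  proof (rule poly_mapping_eqI)
    fix j
    have "Poly_Mapping.lookup (\<Sum>i<d. ?y i) j = (\<Sum>i<d. if i = j then Poly_Mapping.lookup x i else 0)"
      by (simp add: lookup_sum lookup_single when_def if_distrib cong: if_cong)
    also have "\<dots> = Poly_Mapping.lookup x j"
      using x by (simp add: in_Rd_iff)
    finally show "Poly_Mapping.lookup x j = Poly_Mapping.lookup (\<Sum>i<d. ?y i) j" ..
  qed
  then have "N x \<le> (\<Sum>i<d. N (?y i))"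
    using norm_on_sum_le[OF N, of "{..<d}" ?y] e Rd_scaleR by auto
  also have "\<dots> \<le> (\<Sum>i<d. norm x * N (Poly_Mapping.single i 1))"
  proof (rule sum_mono)
    fix i assume i: "i \<in> {..<d}"
    have "\<bar>Poly_Mapping.lookup x i\<bar> \<le> norm x"
      unfolding norm_Rd[OF x] using i by (intro member_le_sum) auto
    then show "N (?y i) \<le> norm x * N (Poly_Mapping.single i 1)"
      using norm_onD(4)[OF N e] Ne i by (auto intro: mult_right_mono)
  qed
  also have "\<dots> = C * norm x"
    by (simp add: C_def sum_distrib_left mult.commute)
  finally show "N x \<le> C * norm x" .
qed

text \<open>
  The norm \<open>N\<close> is continuous with respect to the ambient l1 norm, hence bounded away from 0 on the
  compact l1 unit sphere. This direction of the equivalence of norms makes the supremum in the dual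
  norm finite.
\<close>

lemma norm_le_norm_on:
  assumes N: "is_norm_on d N"
  obtains C where "0 \<le> C" "\<And>x. x \<in> Rd d \<Longrightarrow> norm x \<le> C * N x"
proof -
  let ?S = "{x \<in> Rd d. \<forall>i. \<bar>Poly_Mapping.lookup x i\<bar> \<le> 1} \<inter> {x. norm x = 1}"
  have "closed {x::rvec. norm x = 1}"
    by (intro closed_Collect_eq continuous_intros)
  then have comp: "compact ?S"
    using compact_unit_cube by (intro compact_Int_closed) auto
  have in_S: "x \<in> ?S" if "x \<in> Rd d" "norm x = 1" for x
  proof -
    have "\<bar>Poly_Mapping.lookup x i\<bar> \<le> 1" for i
    proof (cases "i < d")
      case True
      then show ?thesis
        using that norm_Rd[of x d] member_le_sum[of i "{..<d}" "\<lambda>i. \<bar>Poly_Mapping.lookup x i\<bar>"] by auto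
    next
      case False
      then show ?thesis using that by (simp add: in_Rd_iff)
    qed
    with that show ?thesis by auto
  qed
  obtain B where B: "0 \<le> B" "\<And>x. x \<in> Rd d \<Longrightarrow> N x \<le> B * norm x"
    using norm_on_le_norm[OF N] by blast
  have "\<bar>N x - N y\<bar> \<le> B * norm (x - y)" if "x \<in> Rd d" "y \<in> Rd d" for x y
  proof -
    have "N x \<le> N (x - y) + N y" "N y \<le> N (y - x) + N x"
      using norm_onD(5)[OF N Rd_diff[OF that] that(2)]
        norm_onD(5)[OF N Rd_diff[OF that(2,1)] that(1)] by simp_all
    moreover have "N (x - y) \<le> B * norm (x - y)" "N (y - x) \<le> B * norm (x - y)"
      using B(2)[OF Rd_diff[OF that]] B(2)[OF Rd_diff[OF that(2,1)]] by (simp_all add: norm_minus_commute)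
    ultimately show ?thesis by linarith
  qed
  then have "B-lipschitz_on (Rd d) N"
    using B(1) by (intro lipschitz_onI) (auto simp: dist_norm)
  then have "continuous_on (Rd d) N"
    by (rule lipschitz_on_continuous_on)
  then have cont: "continuous_on ?S N"
    by (rule continuous_on_subset) auto
  show thesis
  proof (cases "?S = {}")
    case True
    have "x = 0" if x: "x \<in> Rd d" for x
    proof (rule ccontr)
      assume "x \<noteq> 0"
      then have "norm ((1 / norm x) *\<^sub>R x) = 1" by simp
      then show False using in_S[of "(1 / norm x) *\<^sub>R x"] True x by (auto simp: Rd_scaleR)
    qed
    then show thesis using that[of 0] by fastforce
  next
    case False
    then obtain m where m: "m \<in> ?S" "\<And>x. x \<in> ?S \<Longrightarrow> N m \<le> N x"
      using continuous_attains_inf[OF comp False cont] by blast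
    have "m \<noteq> 0" using m(1) by auto
    then have pos: "0 < N m"
      using norm_onD(3)[OF N] m(1) by auto
    have "norm x \<le> (1 / N m) * N x" if x: "x \<in> Rd d" for x
    proof (cases "x = 0")
      case True
      then show ?thesis using norm_onD(1)[OF N] by simp
    next
      case False
      then have "(1 / norm x) *\<^sub>R x \<in> ?S"
        using x by (intro in_S) (auto simp: Rd_scaleR)
      then have "N m \<le> N ((1 / norm x) *\<^sub>R x)" by (rule m(2))
      also have "\<dots> = (1 / norm x) * N x"
        using norm_onD(4)[OF N x] by simp
      finally show ?thesis
        using pos False by (simp add: field_simps)
    qed
    then show thesis using that[of "1 / N m"] pos by simp
  qed
qed

lemma dual_norm_bdd:
  assumes N: "is_norm_on d N"
  shows "bdd_above (dotp d u ` {y \<in> Rd d. N y \<le> 1})"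
proof -
  obtain C where C: "0 \<le> C" "\<And>x. x \<in> Rd d \<Longrightarrow> norm x \<le> C * N x"
    using norm_le_norm_on[OF N] by blast
  have "dotp d u y \<le> (\<Sum>i<d. \<bar>Poly_Mapping.lookup u i\<bar> * C)" if y: "y \<in> Rd d" "N y \<le> 1" for y
    unfolding dotp_def
  proof (rule sum_mono)
    fix i assume i: "i \<in> {..<d}"
    have "\<bar>Poly_Mapping.lookup y i\<bar> \<le> norm y"
      unfolding norm_Rd[OF y(1)] using i by (intro member_le_sum) auto
    also have "\<dots> \<le> C" using C(2)[OF y(1)] mult_left_mono[OF y(2) C(1)] by simp
    finally have "\<bar>Poly_Mapping.lookup u i\<bar> * \<bar>Poly_Mapping.lookup y i\<bar> \<le> \<bar>Poly_Mapping.lookup u i\<bar> * C"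
      by (intro mult_left_mono) auto
    then show "Poly_Mapping.lookup u i * Poly_Mapping.lookup y i \<le> \<bar>Poly_Mapping.lookup u i\<bar> * C"
      by (metis abs_ge_self abs_mult order_trans)
  qed
  then show ?thesis by (intro bdd_aboveI2) auto
qed

lemma dual_norm_nonneg:
  assumes N: "is_norm_on d N"
  shows "0 \<le> dual_norm d N u"
proof -
  have "0 \<in> {y \<in> Rd d. N y \<le> 1}" using norm_onD(1)[OF N] by simp
  from cSUP_upper[OF this dual_norm_bdd[OF N]] show ?thesis
    by (simp add: dual_norm_def dotp_def)
qed

lemma dotp_le_dual_norm:
  assumes N: "is_norm_on d N" and y: "y \<in> Rd d"
  shows "dotp d u y \<le> dual_norm d N u * N y"
proof (cases "y = 0")
  case True
  then show ?thesis using norm_onD(1)[OF N] by (simp add: dotp_def)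
next
  case False
  then have pos: "0 < N y" by (rule norm_onD(3)[OF N y])
  have "(1 / N y) *\<^sub>R y \<in> {y \<in> Rd d. N y \<le> 1}"
    using norm_onD(4)[OF N y] y pos by (simp add: Rd_scaleR)
  from cSUP_upper[OF this dual_norm_bdd[OF N]] have "dotp d u ((1 / N y) *\<^sub>R y) \<le> dual_norm d N u"
    by (simp add: dual_norm_def)
  then show ?thesis using pos by (simp add: dotp_scaleR_right field_simps)
qed

lemma dual_norm_diff_le:
  assumes N: "is_norm_on d N"
  shows "dual_norm d N (u - v) \<le> dual_norm d N u + dual_norm d N v"
  unfolding dual_norm_def[of d N "u - v"]
proof (rule cSUP_least)
  show "{y \<in> Rd d. N y \<le> 1} \<noteq> {}" using norm_onD(1)[OF N] Rd_zero by (metis (mono_tags, lifting) empty_iff mem_Collect_eq zero_le_one)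
  fix y assume y: "y \<in> {y \<in> Rd d. N y \<le> 1}"
  then have y': "-1 *\<^sub>R y \<in> {y \<in> Rd d. N y \<le> 1}" 
    using norm_onD(4)[OF N, of y "-1"] Rd_scaleR[of y d "-1"] by auto
  have "dotp d u y \<le> dual_norm d N u"
    unfolding dual_norm_def by (rule cSUP_upper[OF y dual_norm_bdd[OF N]])
  moreover have "dotp d v (-1 *\<^sub>R y) \<le> dual_norm d N v"
    unfolding dual_norm_def by (rule cSUP_upper[OF y' dual_norm_bdd[OF N]])
  then have "- dotp d v y \<le> dual_norm d N v" unfolding dotp_scaleR_right by simp
  ultimately show "dotp d (u - v) y \<le> dual_norm d N u + dual_norm d N v"
    by (simp add: dotp_diff_left)
qed

section \<open>First-order inequalities along segments\<close>

lemma has_gradient_along_segment: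
  assumes X: "convex X" "a \<in> X" "b \<in> X" and s: "s \<in> {0..1}"
    and h: "\<And>p. p \<in> X \<Longrightarrow> has_gradient_within d h (v p) p X"
  shows "((\<lambda>s. h (a + s *\<^sub>R (b - a))) has_real_derivative
            dotp d (v (a + s *\<^sub>R (b - a))) (b - a)) (at s within {0..1})"
proof -
  have in_X: "a + r *\<^sub>R (b - a) \<in> X" if "r \<in> {0..1}" for r
    using X that convexD_alt[of X a b r] by (simp add: algebra_simps)
  have "((\<lambda>r. a + r *\<^sub>R (b - a)) has_derivative (\<lambda>r. r *\<^sub>R (b - a))) (at s within {0..1})"
    by (auto intro!: derivative_eq_intros)
  from has_derivative_in_compose2[OF _ _ s this, of X h "\<lambda>p. dotp d (v p)"]
  have "((\<lambda>r. h (a + r *\<^sub>R (b - a))) has_derivative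
          (\<lambda>r. dotp d (v (a + s *\<^sub>R (b - a))) (r *\<^sub>R (b - a)))) (at s within {0..1})"
    using h in_X by (auto simp: has_gradient_within_def image_subset_iff)
  then show ?thesis
    by (simp add: has_field_derivative_def dotp_scaleR_right mult.commute[of _ "dotp _ _ _"])
qed

text \<open>
  Applied along segments, this yields both the gradient inequality of convex functions and the
  optimality condition of a proximal step.
\<close>

lemma right_derivative_nonneg_at_min:
  fixes \<phi> :: "real \<Rightarrow> real"
  assumes "(\<phi> has_real_derivative l) (at 0 within {0..1})"
    and "\<And>s. s \<in> {0..1} \<Longrightarrow> \<phi> 0 \<le> \<phi> s"
  shows "0 \<le> l"
proof (rule ccontr)
  assume "\<not> 0 \<le> l"
  then obtain e where e: "e > 0" "\<And>h. h > 0 \<Longrightarrow> 0 + h \<in> {0..1} \<Longrightarrow> h < e \<Longrightarrow> \<phi> (0 + h) < \<phi> 0"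
    using has_real_derivative_neg_dec_right[OF assms(1)] by auto
  define h where "h = min (e / 2) 1"
  have "\<phi> (0 + h) < \<phi> 0" by (rule e(2)) (use e(1) in \<open>auto simp: h_def\<close>)
  moreover have "\<phi> 0 \<le> \<phi> h" by (rule assms(2)) (use e(1) in \<open>auto simp: h_def\<close>)
  ultimately show False by simp
qed

text \<open>
  Bounding \<open>\<phi>'\<close> by its largest possible value would give \<open>c\<close> instead of \<open>c / 2\<close>, for
  which the step sizes of the algorithm are too small. The proof applies the mean value theorem to
  \<open>\<phi>\<close> minus its quadratic majorant.
\<close>

lemma increment_le_quadratic:
  fixes \<phi> :: "real \<Rightarrow> real"
  assumes der: "\<And>s. s \<in> {0..1} \<Longrightarrow> (\<phi> has_real_derivative \<phi>' s) (at s within {0..1})"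
    and le: "\<And>s. s \<in> {0..1} \<Longrightarrow> \<phi>' s \<le> \<phi>' 0 + c * s"
  shows "\<phi> 1 \<le> \<phi> 0 + \<phi>' 0 + c / 2"
proof -
  define \<psi> where "\<psi> s = \<phi> s - \<phi>' 0 * s - c / 2 * s\<^sup>2" for s
  have "(\<psi> has_derivative (\<lambda>h. h * (\<phi>' s - \<phi>' 0 - c * s))) (at s within {0..1})"
    if "s \<in> {0..1}" for s
  proof -
    have "(\<psi> has_real_derivative (\<phi>' s - \<phi>' 0 - c * s)) (at s within {0..1})"
      unfolding \<psi>_def by (rule derivative_eq_intros der[OF that] refl | simp)+
    then show ?thesis
      by (simp add: has_field_derivative_def mult.commute[of _ "\<phi>' s - \<phi>' 0 - c * s"])
  qed
  then obtain s where s: "s \<in> {0<..<1}" "\<psi> 1 - \<psi> 0 = (1 - 0) * (\<phi>' s - \<phi>' 0 - c * s)"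
    using mvt_simple[of 0 1 \<psi> "\<lambda>s h. h * (\<phi>' s - \<phi>' 0 - c * s)"] by auto
  then have "\<psi> 1 \<le> \<psi> 0" using le[of s] by simp
  then show ?thesis by (simp add: \<psi>_def)
qed

lemma convex_on_gradient_ineq:
  assumes h: "convex_on X h" "\<And>p. p \<in> X \<Longrightarrow> has_gradient_within d h (v p) p X"
    and ab: "a \<in> X" "b \<in> X"
  shows "h a + dotp d (v a) (b - a) \<le> h b"
proof -
  have X: "convex X" using h(1) by (rule convex_on_imp_convex)
  let ?\<phi> = "\<lambda>s. s * (h b - h a) - h (a + s *\<^sub>R (b - a))"
  have "((\<lambda>s. s * (h b - h a)) has_real_derivative (h b - h a)) (at 0 within {0..1})"
    by (auto intro!: derivative_eq_intros)
  from DERIV_diff[OF this has_gradient_along_segment[OF X ab _ h(2), of 0]]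
  have "(?\<phi> has_real_derivative (h b - h a) - dotp d (v a) (b - a)) (at 0 within {0..1})"
    by simp
  moreover have "?\<phi> 0 \<le> ?\<phi> s" if "s \<in> {0..1}" for s
  proof -
    have "h ((1 - s) *\<^sub>R a + s *\<^sub>R b) \<le> (1 - s) * h a + s * h b"
      using h(1) ab that by (intro convex_onD) auto
    then show ?thesis by (simp add: algebra_simps)
  qed
  ultimately have "0 \<le> (h b - h a) - dotp d (v a) (b - a)"
    by (rule right_derivative_nonneg_at_min)
  then show ?thesis by simp
qed

lemma smooth_increment_le:
  assumes N: "is_norm_on d N" and X: "convex X" "X \<subseteq> Rd d" and ab: "a \<in> X" "b \<in> X"
    and h: "\<And>p. p \<in> X \<Longrightarrow> has_gradient_within d h (v p) p X"
    and L: "\<And>p q. p \<in> X \<Longrightarrow> q \<in> X \<Longrightarrow> dual_norm d N (v p - v q) \<le> L * N (p - q)"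
  shows "h b \<le> h a + dotp d (v a) (b - a) + L / 2 * (N (b - a))\<^sup>2"
proof -
  have ba: "b - a \<in> Rd d" using X ab by (auto intro: Rd_diff)
  let ?p = "\<lambda>s. a + s *\<^sub>R (b - a)"
  have "h (?p 1) \<le> h (?p 0) + dotp d (v (?p 0)) (b - a) + (L * (N (b - a))\<^sup>2) / 2"
  proof (rule increment_le_quadratic[where \<phi> = "\<lambda>s. h (?p s)" and \<phi>' = "\<lambda>s. dotp d (v (?p s)) (b - a)"])
    fix s :: real assume s: "s \<in> {0..1}"
    show "((\<lambda>s. h (?p s)) has_real_derivative dotp d (v (?p s)) (b - a)) (at s within {0..1})"
      by (rule has_gradient_along_segment[OF X(1) ab s h])
    have p: "?p s \<in> X"
      using X ab s convexD_alt[of X a b s] by (simp add: algebra_simps)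
    have Ns: "N (s *\<^sub>R (b - a)) = s * N (b - a)"
      using norm_onD(4)[OF N ba] s by simp
    have Nba: "0 \<le> N (b - a)" by (rule norm_onD(2)[OF N ba])
    have "dotp d (v (?p s) - v a) (b - a) \<le> dual_norm d N (v (?p s) - v a) * N (b - a)"
      by (rule dotp_le_dual_norm[OF N ba])
    also have "\<dots> \<le> (L * (s * N (b - a))) * N (b - a)"
      using L[OF p ab(1)] Nba Ns by (intro mult_right_mono) auto
    finally show "dotp d (v (?p s)) (b - a) \<le> dotp d (v (?p 0)) (b - a) + L * (N (b - a))\<^sup>2 * s"
      by (simp add: dotp_diff_left power2_eq_square algebra_simps)
  qed
  then show ?thesis by simp
qed

context mirror_map begin

text \<open>
  This is \<open>increment_le_quadratic\<close> for \<open>- \<omega>\<close> along the segment, as strong monotonicity of the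
  gradient gives the derivative bound.
\<close>

lemma bregman_ge:
  assumes N: "is_norm_on d N" and X: "X \<subseteq> Rd d" and ab: "a \<in> X" "b \<in> X"
  shows "\<rho> / 2 * (N (b - a))\<^sup>2 \<le> bregman d \<omega> g\<omega> b a"
proof -
  have cX: "convex X" using \<omega>_strictly_convex by (simp add: strictly_convex_on_def)
  have ba: "b - a \<in> Rd d" using X ab by (auto intro: Rd_diff)
  let ?p = "\<lambda>s. a + s *\<^sub>R (b - a)"
  have "- \<omega> (?p 1) \<le> - \<omega> (?p 0) + - dotp d (g\<omega> (?p 0)) (b - a) + (- (\<rho> * (N (b - a))\<^sup>2)) / 2"
  proof (rule increment_le_quadratic[where \<phi> = "\<lambda>s. - \<omega> (?p s)" and \<phi>' = "\<lambda>s. - dotp d (g\<omega> (?p s)) (b - a)"])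
    fix s :: real assume s: "s \<in> {0..1}"
    show "((\<lambda>s. - \<omega> (?p s)) has_real_derivative - dotp d (g\<omega> (?p s)) (b - a)) (at s within {0..1})"
      by (intro DERIV_minus has_gradient_along_segment[OF cX ab s \<omega>_grad])
    have p: "?p s \<in> X"
      using cX ab s convexD_alt[of X a b s] by (simp add: algebra_simps)
    have Ns: "N (s *\<^sub>R (b - a)) = s * N (b - a)"
      using norm_onD(4)[OF N ba] s by simp
    have "s * (\<rho> * s * (N (b - a))\<^sup>2) \<le> s * dotp d (b - a) (g\<omega> (?p s) - g\<omega> a)"
      using \<omega>_strongly_convex[OF p ab(1)] Ns
      by (simp add: dotp_scaleR_left power_mult_distrib power2_eq_square mult_ac)
    then have "\<rho> * s * (N (b - a))\<^sup>2 \<le> dotp d (b - a) (g\<omega> (?p s) - g\<omega> a)"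
      if "s \<noteq> 0" using that s by simp
    then show "- dotp d (g\<omega> (?p s)) (b - a) \<le> - dotp d (g\<omega> (?p 0)) (b - a) + - (\<rho> * (N (b - a))\<^sup>2) * s"
      by (cases "s = 0") (auto simp: dotp_diff_right dotp_commute[of d "b - a"] mult_ac)
  qed
  then show ?thesis by (simp add: bregman_def)
qed

text \<open>
  The derivative of the objective at the minimiser \<open>m\<close> towards \<open>y\<close> is nonnegative. The gradient of
  the divergence in its first argument is \<open>g\<omega> m - g\<omega> z\<close>, and its product with \<open>y - m\<close> is exactly the combination
  of three divergences on the right.
\<close>

lemma prox_three_point:
  assumes m: "is_arg_min (\<lambda>y. dotp d u y + a * bregman d \<omega> g\<omega> y z) (\<lambda>y. y \<in> X) m"
    and y: "y \<in> X"
  shows "dotp d u (m - y) \<le>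
    a * (bregman d \<omega> g\<omega> y z - bregman d \<omega> g\<omega> y m - bregman d \<omega> g\<omega> m z)"
proof -
  have cX: "convex X" using \<omega>_strictly_convex by (simp add: strictly_convex_on_def)
  let ?J = "\<lambda>y. dotp d u y + a * bregman d \<omega> g\<omega> y z"
  let ?p = "\<lambda>s. m + s *\<^sub>R (y - m)"
  have mX: "m \<in> X" and min: "\<And>p. p \<in> X \<Longrightarrow> ?J m \<le> ?J p"
    using m by (auto simp: is_arg_min_linorder)
  have J: "?J (?p s) = dotp d u m + s * dotp d u (y - m)
      + a * (\<omega> (?p s) - \<omega> z - dotp d (g\<omega> z) (m - z) - s * dotp d (g\<omega> z) (y - m))" for s
    by (simp add: bregman_def dotp_add_right dotp_diff_right dotp_scaleR_right algebra_simps)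
  have "((\<lambda>s. \<omega> (?p s)) has_real_derivative dotp d (g\<omega> (?p 0)) (y - m)) (at 0 within {0..1})"
    by (rule has_gradient_along_segment[OF cX mX y _ \<omega>_grad]) auto
  then have D: "((\<lambda>s. \<omega> (?p s)) has_real_derivative dotp d (g\<omega> m) (y - m)) (at 0 within {0..1})"
    by simp
  have "((\<lambda>s. ?J (?p s)) has_real_derivative
      dotp d u (y - m) + a * (dotp d (g\<omega> m) (y - m) - dotp d (g\<omega> z) (y - m))) (at 0 within {0..1})"
    unfolding J by (rule derivative_eq_intros D refl | simp)+
  moreover have "?J (?p 0) \<le> ?J (?p s)" if "s \<in> {0..1}" for s
  proof -
    have "?p s \<in> X"
      using cX mX y that convexD_alt[of X m y s] by (simp add: algebra_simps)
    then show ?thesis using min by simp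
  qed
  ultimately have "0 \<le> dotp d u (y - m) + a * (dotp d (g\<omega> m) (y - m) - dotp d (g\<omega> z) (y - m))"
    by (rule right_derivative_nonneg_at_min)
  then show ?thesis
    by (simp add: bregman_def dotp_diff_right algebra_simps)
qed

end

section \<open>Elementary inequalities\<close>

lemma self_le_half_one_plus_square: "a \<le> (1 + a\<^sup>2) / 2" for a :: real
  using zero_le_power2[of "a - 1"] by (simp add: power2_eq_square algebra_simps)

lemma product_le_weighted_squares:
  fixes a b c :: real
  assumes "0 < c"
  shows "a * b \<le> c / 2 * a\<^sup>2 + b\<^sup>2 / (2 * c)"
proof -
  have "0 \<le> (c * a - b)\<^sup>2 / (2 * c)" using assms by simp
  also have "\<dots> = c / 2 * a\<^sup>2 + b\<^sup>2 / (2 * c) - a * b"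
    using assms by (simp add: power2_eq_square field_simps)
  finally show ?thesis by simp
qed

lemma le_of_square_le_linear:
  fixes m a b c :: real
  assumes "m\<^sup>2 \<le> a\<^sup>2 + b + c * m" "0 \<le> a" "1 \<le> b" "0 \<le> c"
  shows "m \<le> a + b + c"
proof (rule ccontr)
  assume "\<not> m \<le> a + b + c"
  then have m: "a + b + c < m" by simp
  have "a * a \<le> a * m" "b * 1 \<le> b * m"
    using assms m by (intro mult_left_mono; simp)+
  moreover have "(a + b + c) * m < m * m"
    using m assms by (intro mult_strict_right_mono) auto
  ultimately show False using assms(1) by (simp add: power2_eq_square algebra_simps)
qed

lemma sum_squares_le_square_sum:
  fixes h :: "'a \<Rightarrow> real"
  assumes "finite A" "\<And>i. i \<in> A \<Longrightarrow> 0 \<le> h i"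
  shows "(\<Sum>i\<in>A. (h i)\<^sup>2) \<le> (\<Sum>i\<in>A. h i)\<^sup>2"
  using assms
proof (induction A rule: finite_induct)
  case (insert i A)
  have "0 \<le> h i * sum h A" using insert by (intro mult_nonneg_nonneg sum_nonneg) auto
  then show ?case using insert by (simp add: power2_sum)
qed simp

section \<open>Drift analysis of the algorithm\<close>

context bounded_online_problem begin

text \<open>
  The supremum is over a bounded set, since gradients have dual norm at most \<open>F\<close>.
\<close>

lemma variation_term_le:
  assumes p: "p \<in> X"
  shows "(dual_norm d N (gf t p - gf s p))\<^sup>2 \<le> (SUP p\<in>X. (dual_norm d N (gf t p - gf s p))\<^sup>2)"
proof (rule cSUP_upper[OF p])
  show "bdd_above ((\<lambda>p. (dual_norm d N (gf t p - gf s p))\<^sup>2) ` X)"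
  proof (rule bdd_aboveI2)
    fix p assume p: "p \<in> X"
    have "dual_norm d N (gf t p - gf s p) \<le> F + F"
      using dual_norm_diff_le[OF norm_N, of "gf t p" "gf s p"] f_grad_bound[OF p, of t]
        f_grad_bound[OF p, of s] by linarith
    then show "(dual_norm d N (gf t p - gf s p))\<^sup>2 \<le> (F + F)\<^sup>2"
      by (intro power_mono dual_norm_nonneg norm_N)
  qed
qed

lemma gradient_variation_nonneg: "0 \<le> gradient_variation d N X gf T"
proof -
  obtain p where "p \<in> X" using X_nonempty by auto
  then show ?thesis
    unfolding gradient_variation_def
    by (intro sum_nonneg) (use variation_term_le zero_le_power2 order_trans in blast)
qed

end

text \<open>
  A run together with a Slater point \<open>z\<close>. Of the formulas for \<open>\<gamma>\<close> and \<open>\<eta>\<close> the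
  analysis keeps three consequences: \<open>\<gamma> \<ge> 1\<close>, the relation \<open>\<eta> = 1 / \<gamma>\<^sup>2\<close>, and that
  \<open>\<eta>\<close> times the gradient variation is of order \<open>\<gamma>\<^sup>2\<close>.
\<close>

locale mirror_prox_analysis =
  bounded_online_problem d K N X f gf g gg F Lf G Hk Lg +
  mirror_map d N X \<omega> g\<omega> \<rho> +
  mirror_prox_run d K X gf g gg \<omega> g\<omega> \<gamma> \<alpha> x w Q
  for d K N X f gf g gg F Lf G Hk Lg \<omega> g\<omega> \<rho> \<gamma> \<alpha> x w Q +
  fixes H \<sigma> R \<eta> :: real and T :: nat and z :: rvec
  assumes H_eq: "H = (\<Sum>k=1..K. Hk k)"
    and \<sigma>_pos: "0 < \<sigma>" and z_in: "z \<in> X"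
    and z_slater: "\<And>k. k \<in> {1..K} \<Longrightarrow> g k z \<le> - \<sigma>"
    and bregman_le: "\<And>a b. a \<in> X \<Longrightarrow> b \<in> X \<Longrightarrow> bregman d \<omega> g\<omega> a b \<le> R\<^sup>2"
    and \<gamma>_ge_1: "1 \<le> \<gamma>" and \<eta>_eq: "\<eta> = inverse (\<gamma>\<^sup>2)"
    and variation_le: "\<eta> * gradient_variation d N X gf T \<le> \<gamma>\<^sup>2"
    and \<alpha>_0: "\<alpha> 0 = 0"
    and \<alpha>_step: "\<And>t. 1 \<le> t \<Longrightarrow> \<alpha> t = max (2 / \<rho> * (\<gamma>\<^sup>2 * Lg * G + \<eta> * Lf\<^sup>2 + inverse \<eta> +
          (\<gamma> * Lg * (\<Sum>k=1..K. \<bar>Q t k\<bar>) + \<gamma>\<^sup>2 * (Lg * G + H\<^sup>2)))) (\<alpha> (t - 1))"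
begin

abbreviation D where "D \<equiv> bregman d \<omega> g\<omega>"

definition Q1 :: "nat \<Rightarrow> real" where "Q1 t = (\<Sum>k=1..K. \<bar>Q t k\<bar>)"
definition Q2 :: "nat \<Rightarrow> real" where "Q2 t = (\<Sum>k=1..K. (Q t k)\<^sup>2)"
definition g2 :: "rvec \<Rightarrow> real" where "g2 p = (\<Sum>k=1..K. (g k p)\<^sup>2)"
text \<open>
  The multiplier of the linearised constraint \<open>k\<close> in both proximal steps. The update
  rule of \<open>Q\<close> is designed to make it nonnegative.
\<close>

definition q :: "nat \<Rightarrow> nat \<Rightarrow> real" where "q t k = Q t k + \<gamma> * g k (x (t - 1))"

text \<open>
  Twice the total coefficient of \<open>(N (x t - x (t - 1)))\<^sup>2\<close> among the second-order errors of
  round \<open>t\<close>.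
\<close>

definition \<beta> :: "nat \<Rightarrow> real" where
  "\<beta> t = \<gamma> * Lg * Q1 t + \<gamma>\<^sup>2 * Lg * G + \<gamma>\<^sup>2 * H\<^sup>2 + \<eta> * Lf\<^sup>2"

definition \<epsilon> :: "nat \<Rightarrow> real" where "\<epsilon> t = dual_norm d N (gf t (x t) - gf (t - 1) (x t))"

text \<open>
  The first term is the quantity to be controlled. The second one telescopes the differences that
  arise because the multipliers use \<open>g\<close> at the previous iterate. The third one telescopes the
  divergences from the comparison point; subtracting \<open>R\<^sup>2\<close> makes it nonpositive, so that an
  increase of the step size can only decrease it. The last one pays for the part
  of the next movement \<open>N (x t - x (t - 1))\<close> that goes through \<open>w t\<close>.
\<close>

definition \<Phi> :: "nat \<Rightarrow> real" where
  "\<Phi> t = Q2 t / 2 - \<gamma>\<^sup>2 / 2 * g2 (x (t - 1)) + \<alpha> t * (D z (w t) - R\<^sup>2)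
         + \<beta> t * (N (w t - x (t - 1)))\<^sup>2"

lemma x_in: "x t \<in> X"
proof (cases t)
  case 0
  then show ?thesis using init_x by simp
next
  case (Suc n)
  then show ?thesis using step_x[of t] by (simp add: is_arg_min_linorder)
qed

lemma w_in: "1 \<le> t \<Longrightarrow> w t \<in> X"
proof -
  assume t: "1 \<le> t"
  show ?thesis
  proof (cases "t = 1")
    case True
    then show ?thesis using init_w by simp
  next
    case False
    then have "1 \<le> t - 1" "t = t - 1 + 1" using t by auto
    then show ?thesis using step_w[of "t - 1"] by (metis is_arg_min_linorder)
  qed
qed

lemma F_nonneg: "0 \<le> F"
  using f_grad_bound[OF z_in, of 0] dual_norm_nonneg[OF norm_N, of "gf 0 z"] by simp

lemma G_nonneg: "0 \<le> G"
  by (rule order_trans[OF sum_nonneg g_bound[OF z_in]]) auto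

lemma \<eta>_pos: "0 < \<eta>" and \<eta>_le_1: "\<eta> \<le> 1" and inverse_\<eta>: "inverse \<eta> = \<gamma>\<^sup>2"
  using \<gamma>_ge_1 unfolding \<eta>_eq by (auto simp: inverse_le_1_iff one_le_power)

lemma X_Rd: "p \<in> X \<Longrightarrow> p \<in> Rd d"
  using X_sub by auto

lemma N_diff_nonneg: "a \<in> X \<Longrightarrow> b \<in> X \<Longrightarrow> 0 \<le> N (a - b)"
  by (intro norm_onD(2)[OF norm_N] Rd_diff X_Rd)

lemma N_commute: "a \<in> X \<Longrightarrow> b \<in> X \<Longrightarrow> N (a - b) = N (b - a)"
  by (intro norm_on_minus_commute[OF norm_N] X_Rd)

lemma D_ge: "a \<in> X \<Longrightarrow> b \<in> X \<Longrightarrow> \<rho> / 2 * (N (a - b))\<^sup>2 \<le> D a b"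
  by (rule bregman_ge[OF norm_N X_sub])

lemma D_nonneg: "a \<in> X \<Longrightarrow> b \<in> X \<Longrightarrow> 0 \<le> D a b"
  using D_ge[of a b] \<rho>_pos by (meson order_trans less_imp_le mult_nonneg_nonneg zero_le_power2 divide_nonneg_pos zero_less_numeral)

text \<open>
  The natural bound is the square root of \<open>2 * R\<^sup>2 / \<rho>\<close>; this weaker one is polynomial in \<open>R\<close> and
  \<open>1 / \<rho>\<close>.
\<close>

lemma diameter_le:
  assumes "a \<in> X" "b \<in> X"
  shows "N (a - b) \<le> 1 + R\<^sup>2 / \<rho>"
proof -
  have "\<rho> / 2 * (N (a - b))\<^sup>2 \<le> R\<^sup>2"
    using D_ge bregman_le assms by (meson order_trans)
  then have "(N (a - b))\<^sup>2 / 2 \<le> R\<^sup>2 / \<rho>" using \<rho>_pos by (simp add: field_simps)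
  moreover have "N (a - b) \<le> 1 + r" if "(N (a - b))\<^sup>2 / 2 \<le> r" for r
  proof -
    have "0 \<le> r" using that zero_le_power2[of "N (a - b)"] by linarith
    then show ?thesis
      using that self_le_half_one_plus_square[of "N (a - b)"] by (simp add: field_simps)
  qed
  ultimately show ?thesis by blast
qed

lemma g2_nonneg: "0 \<le> g2 p"
  unfolding g2_def by (intro sum_nonneg) auto

lemma g2_le: 
  assumes "p \<in> X"
  shows "g2 p \<le> G\<^sup>2"
proof -
  have "g2 p = (\<Sum>k=1..K. \<bar>g k p\<bar>\<^sup>2)" by (simp add: g2_def)
  also have "\<dots> \<le> (\<Sum>k=1..K. \<bar>g k p\<bar>)\<^sup>2" by (rule sum_squares_le_square_sum) auto
  also have "\<dots> \<le> G\<^sup>2" using g_bound[OF assms] by (intro power_mono sum_nonneg) auto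
  finally show ?thesis .
qed

lemma Q_nonneg: "k \<in> {1..K} \<Longrightarrow> 0 \<le> Q t k"
proof (induction t)
  case (Suc t)
  have "Q (Suc t) k = max (- \<gamma> * g k (x t)) (Q t k + \<gamma> * g k (x t))"
    using step_Q[of "Suc t" k] Suc by simp
  then show ?case using Suc by (auto simp: max_def)
qed (simp add: init_Q)

lemma q_nonneg: "1 \<le> t \<Longrightarrow> k \<in> {1..K} \<Longrightarrow> 0 \<le> q t k"
  using step_Q[of t k] by (simp add: q_def)

lemma Q1_eq: "Q1 t = (\<Sum>k=1..K. Q t k)"
  unfolding Q1_def by (intro sum.cong) (use Q_nonneg in auto)

lemma Q1_nonneg: "0 \<le> Q1 t"
  unfolding Q1_def by (intro sum_nonneg) auto

lemma Q1_step: "Q1 (t + 1) \<le> Q1 t + \<gamma> * G"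
proof -
  have "Q1 (t + 1) \<le> (\<Sum>k=1..K. Q t k + \<gamma> * \<bar>g k (x t)\<bar>)"
    unfolding Q1_eq
  proof (rule sum_mono)
    fix k assume k: "k \<in> {1..K}"
    have "- (\<gamma> * g k (x t)) \<le> \<gamma> * \<bar>g k (x t)\<bar>" "\<gamma> * g k (x t) \<le> \<gamma> * \<bar>g k (x t)\<bar>"
      using \<gamma>_pos by (simp_all add: abs_if)
    then show "Q (t + 1) k \<le> Q t k + \<gamma> * \<bar>g k (x t)\<bar>"
      using step_Q[of "t + 1" k] k Q_nonneg[OF k, of t] by simp
  qed
  also have "\<dots> = Q1 t + \<gamma> * (\<Sum>k=1..K. \<bar>g k (x t)\<bar>)"
    by (simp add: Q1_eq sum.distrib sum_distrib_left)
  also have "\<dots> \<le> Q1 t + \<gamma> * G"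
    using g_bound[OF x_in] \<gamma>_pos by simp
  finally show ?thesis .
qed

lemma Q2_le_Q1_square: "Q2 t \<le> (Q1 t)\<^sup>2"
  unfolding Q2_def Q1_eq by (intro sum_squares_le_square_sum) (use Q_nonneg in auto)

text \<open>
  For a single constraint let \<open>c\<close> and \<open>b\<close> be \<open>\<gamma> * g k\<close> at the new and the old iterate.
  Either branch of the maximum gives \<open>Q t k * c + c\<^sup>2\<close> as a bound. Expressing it by the multiplier
  \<open>Q t k + b\<close> leaves \<open>c\<^sup>2 - b * c\<close>, that is
  \<open>(c - b)\<^sup>2 / 2 + (c\<^sup>2 - b\<^sup>2) / 2\<close>: a squared movement, controlled by Lipschitz continuity,
  and a telescoping difference.
\<close>

lemma drift:
  assumes t: "1 \<le> t"
  shows "Q2 (t + 1) / 2 - Q2 t / 2 \<le> (\<Sum>k=1..K. q t k * \<gamma> * g k (x t))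
    + \<gamma>\<^sup>2 * H\<^sup>2 / 2 * (N (x t - x (t - 1)))\<^sup>2 + \<gamma>\<^sup>2 / 2 * (g2 (x t) - g2 (x (t - 1)))"
proof -
  let ?n = "N (x t - x (t - 1))"
  have "Q2 (t + 1) / 2 - Q2 t / 2 = (\<Sum>k=1..K. (Q (t + 1) k)\<^sup>2 / 2 - (Q t k)\<^sup>2 / 2)"
    by (simp add: Q2_def sum_subtractf sum_divide_distrib)
  also have "\<dots> \<le> (\<Sum>k=1..K. q t k * \<gamma> * g k (x t) + \<gamma>\<^sup>2 / 2 * (Hk k * ?n)\<^sup>2
      + \<gamma>\<^sup>2 / 2 * ((g k (x t))\<^sup>2 - (g k (x (t - 1)))\<^sup>2))"
  proof (rule sum_mono)
    fix k assume k: "k \<in> {1..K}"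
    define c where "c = \<gamma> * g k (x t)"
    define b where "b = \<gamma> * g k (x (t - 1))"
    have "Q (t + 1) k = max (- c) (Q t k + c)"
      using step_Q[of "t + 1" k] k by (simp add: c_def)
    moreover have "0 \<le> (Q t k + c)\<^sup>2" "0 \<le> c\<^sup>2" by simp_all
    ultimately have 1: "(Q (t + 1) k)\<^sup>2 / 2 - (Q t k)\<^sup>2 / 2 \<le> Q t k * c + c\<^sup>2"
      by (auto simp: max_def power2_eq_square algebra_simps)
    have 2: "Q t k * c + c\<^sup>2 = q t k * \<gamma> * g k (x t) + (c - b)\<^sup>2 / 2 + (c\<^sup>2 - b\<^sup>2) / 2"
      by (simp add: q_def c_def b_def power2_eq_square field_simps)
    have "\<bar>g k (x t) - g k (x (t - 1))\<bar>\<^sup>2 \<le> (Hk k * ?n)\<^sup>2"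
      using g_Lipschitz[OF k x_in x_in] by (intro power_mono) auto
    then have "\<gamma>\<^sup>2 * (g k (x t) - g k (x (t - 1)))\<^sup>2 \<le> \<gamma>\<^sup>2 * (Hk k * ?n)\<^sup>2"
      by (intro mult_left_mono) auto
    then have 3: "(c - b)\<^sup>2 \<le> \<gamma>\<^sup>2 * (Hk k * ?n)\<^sup>2"
      by (simp add: c_def b_def power_mult_distrib flip: right_diff_distrib)
    show "(Q (t + 1) k)\<^sup>2 / 2 - (Q t k)\<^sup>2 / 2 \<le> q t k * \<gamma> * g k (x t) + \<gamma>\<^sup>2 / 2 * (Hk k * ?n)\<^sup>2
      + \<gamma>\<^sup>2 / 2 * ((g k (x t))\<^sup>2 - (g k (x (t - 1)))\<^sup>2)"
    proof -
      have "\<gamma>\<^sup>2 / 2 * ((g k (x t))\<^sup>2 - (g k (x (t - 1)))\<^sup>2) = (c\<^sup>2 - b\<^sup>2) / 2"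
        by (simp add: c_def b_def power_mult_distrib algebra_simps)
      with 1 2 3 show ?thesis by simp
    qed
  qed
  also have "\<dots> = (\<Sum>k=1..K. q t k * \<gamma> * g k (x t)) + \<gamma>\<^sup>2 / 2 * ?n\<^sup>2 * (\<Sum>k=1..K. (Hk k)\<^sup>2)
      + \<gamma>\<^sup>2 / 2 * (g2 (x t) - g2 (x (t - 1)))"
    by (simp add: sum.distrib sum_subtractf sum_distrib_left sum_distrib_right sum_divide_distrib
        g2_def power_mult_distrib right_diff_distrib diff_divide_distrib mult_ac)
  also have "\<dots> \<le> (\<Sum>k=1..K. q t k * \<gamma> * g k (x t)) + \<gamma>\<^sup>2 / 2 * ?n\<^sup>2 * H\<^sup>2
      + \<gamma>\<^sup>2 / 2 * (g2 (x t) - g2 (x (t - 1)))"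
    unfolding H_eq using H_nonneg
    by (intro add_mono mult_left_mono sum_squares_le_square_sum) auto
  finally show ?thesis by (simp add: mult_ac)
qed

text \<open>
  The step to \<open>x t\<close> is compared with \<open>w (t + 1)\<close>, and the step to \<open>w (t + 1)\<close> with \<open>z\<close>. In the
  sum the divergence \<open>D (w (t + 1)) (w t)\<close> cancels, and the two steps differ only in the
  loss gradient that they use.
\<close>

lemma mirror_prox_step:
  assumes t: "1 \<le> t"
  shows "dotp d (gf t (x t)) (x t - z) + (\<Sum>k=1..K. q t k * \<gamma> * dotp d (gg k (x (t - 1))) (x t - z))
    \<le> \<alpha> t * (D z (w t) - D z (w (t + 1)) - D (w (t + 1)) (x t) - D (x t) (w t))
      + dotp d (gf t (x t) - gf (t - 1) (x (t - 1))) (x t - w (t + 1))"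
proof -
  define c where "c = (\<Sum>k=1..K. (q t k * \<gamma>) *\<^sub>R gg k (x (t - 1)))"
  have c: "dotp d c y = (\<Sum>k=1..K. q t k * \<gamma> * dotp d (gg k (x (t - 1))) y)" for y
    by (simp add: c_def dotp_sum_left dotp_scaleR_left)
  \<comment> \<open>Both objectives are linear up to the divergence, which is the form of \<open>prox_three_point\<close>.\<close>
  have obj: "prox_objective d K g gg \<omega> g\<omega> \<gamma> (\<alpha> t) v (Q t) (x (t - 1)) (w t)
      = (\<lambda>y. dotp d (v + c) y + \<alpha> t * D y (w t))" for v
    by (rule ext) (simp add: prox_objective_def dotp_add_left c q_def dotp_scaleR_left mult.assoc)
  have "dotp d (gf (t - 1) (x (t - 1)) + c) (x t - w (t + 1))
      \<le> \<alpha> t * (D (w (t + 1)) (w t) - D (w (t + 1)) (x t) - D (x t) (w t))"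
    using step_x[OF t] unfolding obj by (rule prox_three_point) (rule w_in, simp)
  moreover have "dotp d (gf t (x t) + c) (w (t + 1) - z)
      \<le> \<alpha> t * (D z (w t) - D z (w (t + 1)) - D (w (t + 1)) (w t))"
    using step_w[OF t] unfolding obj by (rule prox_three_point) (rule z_in)
  ultimately show ?thesis
    unfolding c[symmetric] by (simp add: dotp_add_left dotp_diff_left dotp_diff_right algebra_simps)
qed

text \<open>
  The value \<open>g k (x t)\<close> exceeds the linearisation at the previous iterate by at most a smoothness
  error, whereas at \<open>z\<close> the linearisation is at most \<open>g k z \<le> - \<sigma>\<close> by convexity. The total weight of the multipliers differs from
  \<open>Q1 t\<close> by at most \<open>\<gamma> * G\<close>.
\<close>

lemma linearised_constraints:
  assumes t: "1 \<le> t"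
  shows "(\<Sum>k=1..K. q t k * \<gamma> * g k (x t)) \<le>
    (\<Sum>k=1..K. q t k * \<gamma> * dotp d (gg k (x (t - 1))) (x t - z)) - \<sigma> * \<gamma> * Q1 t + \<sigma> * \<gamma>\<^sup>2 * G
      + (\<gamma> * Lg * Q1 t + \<gamma>\<^sup>2 * Lg * G) / 2 * (N (x t - x (t - 1)))\<^sup>2"
proof -
  let ?p = "x (t - 1)" and ?n = "(N (x t - x (t - 1)))\<^sup>2"
  have "(\<Sum>k=1..K. q t k * \<gamma> * g k (x t)) \<le>
      (\<Sum>k=1..K. q t k * \<gamma> * (dotp d (gg k ?p) (x t - z) - \<sigma> + Lg / 2 * ?n))"
  proof (rule sum_mono)
    fix k assume k: "k \<in> {1..K}"
    have "g k (x t) \<le> g k ?p + dotp d (gg k ?p) (x t - ?p) + Lg / 2 * ?n"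
      by (rule smooth_increment_le[OF norm_N X_convex X_sub x_in x_in g_grad[OF k] g_smooth[OF k]])
    moreover have "g k ?p + dotp d (gg k ?p) (z - ?p) \<le> g k z"
      by (rule convex_on_gradient_ineq[OF g_convex[OF k] g_grad[OF k] x_in z_in])
    ultimately have "g k (x t) \<le> dotp d (gg k ?p) (x t - z) - \<sigma> + Lg / 2 * ?n"
      using z_slater[OF k] by (simp add: dotp_diff_right)
    then show "q t k * \<gamma> * g k (x t) \<le> q t k * \<gamma> * (dotp d (gg k ?p) (x t - z) - \<sigma> + Lg / 2 * ?n)"
      using q_nonneg[OF t k] \<gamma>_pos by (intro mult_left_mono) auto
  qed
  also have "\<dots> = (\<Sum>k=1..K. q t k * \<gamma> * dotp d (gg k ?p) (x t - z))
      - \<sigma> * \<gamma> * (\<Sum>k=1..K. q t k) + \<gamma> * Lg / 2 * ?n * (\<Sum>k=1..K. q t k)"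
    by (simp add: distrib_left right_diff_distrib sum.distrib sum_subtractf sum_distrib_left
        sum_distrib_right mult_ac)
  finally have 1: "(\<Sum>k=1..K. q t k * \<gamma> * g k (x t)) \<le> (\<Sum>k=1..K. q t k * \<gamma> * dotp d (gg k ?p) (x t - z))
      - \<sigma> * \<gamma> * (\<Sum>k=1..K. q t k) + \<gamma> * Lg / 2 * ?n * (\<Sum>k=1..K. q t k)" .
  have q_eq: "(\<Sum>k=1..K. q t k) = Q1 t + \<gamma> * (\<Sum>k=1..K. g k ?p)"
    by (simp add: q_def Q1_eq sum.distrib sum_distrib_left)
  have "\<bar>\<Sum>k=1..K. g k ?p\<bar> \<le> G"
    by (rule order_trans[OF sum_abs g_bound[OF x_in]])
  then have "\<bar>\<gamma> * (\<Sum>k=1..K. g k ?p)\<bar> \<le> \<gamma> * G"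
    using \<gamma>_pos by (simp add: abs_mult)
  then have "Q1 t - \<gamma> * G \<le> (\<Sum>k=1..K. q t k)" "(\<Sum>k=1..K. q t k) \<le> Q1 t + \<gamma> * G"
    unfolding q_eq by linarith+
  then have "\<sigma> * \<gamma> * (Q1 t - \<gamma> * G) \<le> \<sigma> * \<gamma> * (\<Sum>k=1..K. q t k)"
    "\<gamma> * Lg / 2 * ?n * (\<Sum>k=1..K. q t k) \<le> \<gamma> * Lg / 2 * ?n * (Q1 t + \<gamma> * G)"
    using \<sigma>_pos \<gamma>_pos Lg_nonneg by (intro mult_left_mono; simp)+
  with 1 show ?thesis by (simp add: power2_eq_square field_simps)
qed

text \<open>
  The difference of the two gradients is split at \<open>gf (t - 1) (x t)\<close> into the variation of the losses
  in time and the movement of the iterate. Each product is separated with weight \<open>\<eta>\<close>.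
\<close>

lemma gradient_error:
  assumes t: "1 \<le> t"
  shows "dotp d (gf t (x t) - gf (t - 1) (x (t - 1))) (x t - w (t + 1))
    \<le> \<eta> / 2 * (\<epsilon> t)\<^sup>2 + \<eta> * Lf\<^sup>2 / 2 * (N (x t - x (t - 1)))\<^sup>2 + \<gamma>\<^sup>2 * (N (w (t + 1) - x t))\<^sup>2"
proof -
  let ?y = "x t - w (t + 1)" and ?n = "N (x t - x (t - 1))"
  have w: "w (t + 1) \<in> X" by (rule w_in) simp
  have y: "?y \<in> Rd d" by (intro Rd_diff X_Rd x_in w)
  have Ny: "0 \<le> N ?y" "N ?y = N (w (t + 1) - x t)"
    by (rule N_diff_nonneg[OF x_in w], rule N_commute[OF x_in w])
  have "dotp d (gf t (x t) - gf (t - 1) (x (t - 1))) ?y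
      = dotp d (gf t (x t) - gf (t - 1) (x t)) ?y + dotp d (gf (t - 1) (x t) - gf (t - 1) (x (t - 1))) ?y"
    by (simp add: dotp_diff_left)
  also have "\<dots> \<le> \<epsilon> t * N ?y + dual_norm d N (gf (t - 1) (x t) - gf (t - 1) (x (t - 1))) * N ?y"
    unfolding \<epsilon>_def by (intro add_mono dotp_le_dual_norm norm_N y)
  also have "\<dots> \<le> \<epsilon> t * N ?y + (Lf * ?n) * N ?y"
    using f_smooth[OF x_in x_in] Ny by (simp add: mult_right_mono)
  also have "\<dots> \<le> (\<eta> / 2 * (\<epsilon> t)\<^sup>2 + (N ?y)\<^sup>2 / (2 * \<eta>)) + (\<eta> / 2 * (Lf * ?n)\<^sup>2 + (N ?y)\<^sup>2 / (2 * \<eta>))"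
    by (intro add_mono product_le_weighted_squares \<eta>_pos)
  also have "\<dots> = \<eta> / 2 * (\<epsilon> t)\<^sup>2 + \<eta> * Lf\<^sup>2 / 2 * ?n\<^sup>2 + inverse \<eta> * (N ?y)\<^sup>2"
    using \<eta>_pos by (simp add: power_mult_distrib field_simps)
  finally show ?thesis unfolding inverse_\<eta> Ny(2) .
qed

lemma \<alpha>_mono: "\<alpha> t \<le> \<alpha> (t + 1)"
  using \<alpha>_step[of "t + 1"] by simp

text \<open>
  The summand \<open>\<gamma>\<^sup>2\<close> covers the last term of \<open>gradient_error\<close>; the third one covers
  the possible growth of \<open>\<beta>\<close> in the next round.
\<close>

lemma \<alpha>_ge: "1 \<le> t \<Longrightarrow> \<beta> t + \<gamma>\<^sup>2 + \<gamma>\<^sup>2 * Lg * G \<le> \<rho> / 2 * \<alpha> t"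
proof -
  assume t: "1 \<le> t"
  have "2 / \<rho> * (\<beta> t + \<gamma>\<^sup>2 + \<gamma>\<^sup>2 * Lg * G) \<le> \<alpha> t"
    using \<alpha>_step[OF t] unfolding \<beta>_def Q1_def inverse_\<eta> by (simp add: algebra_simps)
  then show ?thesis using \<rho>_pos by (simp add: field_simps)
qed

lemma \<beta>_nonneg: "0 \<le> \<beta> t"
  unfolding \<beta>_def using Q1_nonneg \<gamma>_pos Lg_nonneg G_nonneg \<eta>_pos
  by (intro add_nonneg_nonneg mult_nonneg_nonneg) auto

lemma \<beta>_le: "1 \<le> t \<Longrightarrow> \<beta> t \<le> \<rho> / 2 * \<alpha> t"
  using \<alpha>_ge[of t] mult_nonneg_nonneg[OF mult_nonneg_nonneg[OF zero_le_power2[of \<gamma>] Lg_nonneg] G_nonneg]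
    zero_le_power2[of \<gamma>] by linarith

lemma \<beta>_Suc_le: "1 \<le> t \<Longrightarrow> \<beta> (t + 1) \<le> \<rho> / 2 * \<alpha> t - \<gamma>\<^sup>2"
proof -
  assume t: "1 \<le> t"
  have "\<gamma> * Lg * Q1 (t + 1) \<le> \<gamma> * Lg * (Q1 t + \<gamma> * G)"
    using Q1_step \<gamma>_pos Lg_nonneg by (intro mult_left_mono) auto
  then have "\<beta> (t + 1) \<le> \<beta> t + \<gamma>\<^sup>2 * Lg * G"
    by (simp add: \<beta>_def power2_eq_square algebra_simps)
  then show ?thesis using \<alpha>_ge[OF t] by simp
qed

text \<open>
  All estimates of one round are added up. The movement \<open>x (t - 1) \<rightarrow> w t \<rightarrow> x t\<close> is split at
  \<open>w t\<close>: the second half is absorbed by \<open>\<alpha> t * D (x t) (w t)\<close>, the first one is paid by the last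
  term of the potential, which in turn is refilled for the next round from
  \<open>\<alpha> t * D (w (t + 1)) (x t)\<close>.
\<close>

lemma potential_step:
  assumes t: "1 \<le> t"
  shows "\<Phi> (t + 1) \<le> \<Phi> t - \<sigma> * \<gamma> * Q1 t + \<sigma> * \<gamma>\<^sup>2 * G + F * (1 + R\<^sup>2 / \<rho>) + \<eta> / 2 * (\<epsilon> t)\<^sup>2"
proof -
  define u where "u = (N (x t - w t))\<^sup>2"
  define e where "e = (N (w t - x (t - 1)))\<^sup>2"
  define e' where "e' = (N (w (t + 1) - x t))\<^sup>2"
  define n where "n = (N (x t - x (t - 1)))\<^sup>2"
  have w: "w t \<in> X" "w (t + 1) \<in> X" using t by (auto intro: w_in)
  have \<alpha>: "0 < \<alpha> t" by (rule \<alpha>_pos[OF t])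
  have n: "n \<le> 2 * u + 2 * e"
  proof -
    have "N (x t - x (t - 1)) \<le> N (x t - w t) + N (w t - x (t - 1))"
      using norm_onD(5)[OF norm_N, of "x t - w t" "w t - x (t - 1)"] X_Rd x_in w by (simp add: Rd_diff)
    then have "n \<le> (N (x t - w t) + N (w t - x (t - 1)))\<^sup>2"
      unfolding n_def using N_diff_nonneg x_in by (intro power_mono) auto
    also have "\<dots> \<le> 2 * u + 2 * e"
      unfolding u_def e_def using sum_squares_bound[of "N (x t - w t)" "N (w t - x (t - 1))"]
      by (simp add: power2_sum)
    finally show ?thesis .
  qed
  have loss: "- dotp d (gf t (x t)) (x t - z) \<le> F * (1 + R\<^sup>2 / \<rho>)"
  proof -
    have "dotp d (gf t (x t)) (z - x t) \<le> dual_norm d N (gf t (x t)) * N (z - x t)"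
      by (intro dotp_le_dual_norm norm_N Rd_diff X_Rd z_in x_in)
    also have "\<dots> \<le> F * (1 + R\<^sup>2 / \<rho>)"
      using f_grad_bound[OF x_in] diameter_le[OF z_in x_in] F_nonneg N_diff_nonneg[OF z_in x_in]
      by (intro mult_mono) auto
    finally show ?thesis by (simp add: dotp_diff_right)
  qed
  have main: "Q2 (t + 1) / 2 - Q2 t / 2 \<le> F * (1 + R\<^sup>2 / \<rho>)
      + \<alpha> t * (D z (w t) - D z (w (t + 1)) - D (w (t + 1)) (x t) - D (x t) (w t))
      + \<eta> / 2 * (\<epsilon> t)\<^sup>2 + \<gamma>\<^sup>2 * e' - \<sigma> * \<gamma> * Q1 t + \<sigma> * \<gamma>\<^sup>2 * G
      + \<beta> t / 2 * n + \<gamma>\<^sup>2 / 2 * (g2 (x t) - g2 (x (t - 1)))"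
    using drift[OF t] linearised_constraints[OF t] mirror_prox_step[OF t] gradient_error[OF t] loss
    unfolding n_def[symmetric] e'_def[symmetric] \<beta>_def by (simp add: algebra_simps add_divide_distrib)
  have "\<alpha> t * (\<rho> / 2 * e') \<le> \<alpha> t * D (w (t + 1)) (x t)" "\<alpha> t * (\<rho> / 2 * u) \<le> \<alpha> t * D (x t) (w t)"
    unfolding e'_def u_def using \<alpha> D_ge[OF w(2) x_in] D_ge[OF x_in w(1)]
    by (intro mult_left_mono; simp)+
  moreover have "\<beta> t / 2 * n \<le> \<beta> t / 2 * (2 * u + 2 * e)"
    using n \<beta>_nonneg[of t] by (intro mult_left_mono) auto
  moreover have "\<beta> t * u \<le> \<rho> / 2 * \<alpha> t * u"
    using \<beta>_le[OF t] by (intro mult_right_mono) (auto simp: u_def)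
  moreover have "\<beta> (t + 1) * e' \<le> (\<rho> / 2 * \<alpha> t - \<gamma>\<^sup>2) * e'"
    using \<beta>_Suc_le[OF t] by (intro mult_right_mono) (auto simp: e'_def)
  moreover have "(\<alpha> (t + 1) - \<alpha> t) * (D z (w (t + 1)) - R\<^sup>2) \<le> 0"
    using \<alpha>_mono[of t] bregman_le[OF z_in w(2)] by (intro mult_nonneg_nonpos) auto
  moreover have "\<Phi> t = Q2 t / 2 - \<gamma>\<^sup>2 / 2 * g2 (x (t - 1)) + \<alpha> t * (D z (w t) - R\<^sup>2) + \<beta> t * e"
    "\<Phi> (t + 1) = Q2 (t + 1) / 2 - \<gamma>\<^sup>2 / 2 * g2 (x t) + \<alpha> (t + 1) * (D z (w (t + 1)) - R\<^sup>2)
      + \<beta> (t + 1) * e'"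
    by (simp_all add: \<Phi>_def e_def e'_def)
  ultimately show ?thesis
    using main by (simp add: algebra_simps)
qed

text \<open>
  For use where the induction restarts: nothing is known there but the size of the dual vector.
\<close>

lemma potential_le:
  assumes t: "1 \<le> t"
  shows "\<Phi> t \<le> (Q1 t)\<^sup>2 / 2 + \<alpha> t * R\<^sup>2"
proof -
  let ?e = "(N (w t - x (t - 1)))\<^sup>2"
  have w: "w t \<in> X" by (rule w_in[OF t])
  have \<alpha>: "0 < \<alpha> t" by (rule \<alpha>_pos[OF t])
  have "\<beta> t * ?e \<le> \<rho> / 2 * \<alpha> t * ?e"
    using \<beta>_le[OF t] by (intro mult_right_mono) auto
  also have "\<dots> = \<alpha> t * (\<rho> / 2 * ?e)" by simp
  also have "\<dots> \<le> \<alpha> t * R\<^sup>2"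
    using \<alpha> order_trans[OF D_ge bregman_le] w x_in by (intro mult_left_mono) auto
  finally have "\<beta> t * ?e \<le> \<alpha> t * R\<^sup>2" .
  moreover have "\<alpha> t * (D z (w t) - R\<^sup>2) \<le> 0"
    using \<alpha> bregman_le[OF z_in w] by (intro mult_nonneg_nonpos) auto
  moreover have "0 \<le> \<gamma>\<^sup>2 / 2 * g2 (x (t - 1))" using g2_nonneg by simp
  ultimately show ?thesis using Q2_le_Q1_square[of t] unfolding \<Phi>_def by simp
qed

lemma Q2_le_potential:
  assumes t: "1 \<le> t"
  shows "Q2 t / 2 \<le> \<Phi> t + \<gamma>\<^sup>2 / 2 * G\<^sup>2 + \<alpha> t * R\<^sup>2"
proof -
  have "0 \<le> \<alpha> t * D z (w t)"
    using \<alpha>_pos[OF t] D_nonneg[OF z_in w_in[OF t]] by simp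
  moreover have "0 \<le> \<beta> t * (N (w t - x (t - 1)))\<^sup>2" using \<beta>_nonneg by simp
  moreover have "\<gamma>\<^sup>2 / 2 * g2 (x (t - 1)) \<le> \<gamma>\<^sup>2 / 2 * G\<^sup>2"
    using g2_le[OF x_in] by (intro mult_left_mono) auto
  ultimately show ?thesis unfolding \<Phi>_def by (simp add: algebra_simps)
qed

lemma sum_gradient_error: "(\<Sum>t=1..T. \<eta> / 2 * (\<epsilon> t)\<^sup>2) \<le> \<gamma>\<^sup>2 / 2"
proof -
  have "(\<Sum>t=1..T. (\<epsilon> t)\<^sup>2) \<le> gradient_variation d N X gf T"
    unfolding gradient_variation_def
  proof (rule sum_mono)
    fix t
    show "(\<epsilon> t)\<^sup>2 \<le> (SUP p\<in>X. (dual_norm d N (gf t p - gf (t - 1) p))\<^sup>2)"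
      unfolding \<epsilon>_def by (rule variation_term_le[OF x_in])
  qed
  then have "\<eta> * (\<Sum>t=1..T. (\<epsilon> t)\<^sup>2) \<le> \<eta> * gradient_variation d N X gf T"
    using \<eta>_pos by simp
  also note variation_le
  finally have "\<eta> * (\<Sum>t=1..T. (\<epsilon> t)\<^sup>2) / 2 \<le> \<gamma>\<^sup>2 / 2" by simp
  then show ?thesis by (simp add: sum_distrib_left sum_divide_distrib)
qed

text \<open>
  The value of \<open>Q1 t\<close> at which the negative drift in \<open>potential_step\<close> balances the positive terms
  other than the variation.
\<close>

definition \<theta> :: real where "\<theta> = \<gamma> * G + F * (1 + R\<^sup>2 / \<rho>) / (\<sigma> * \<gamma>)"

text \<open>
  While \<open>Q1 t > \<theta>\<close> the potential grows by the variation term only. Otherwise \<open>Q1 (t + 1)\<close>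
  is at most \<open>\<theta> + \<gamma> * G\<close>, and \<open>potential_le\<close> bounds the new potential afresh; this is
  also how the induction starts, as \<open>Q 0\<close> vanishes.
\<close>

lemma potential_bound:
  assumes A: "\<And>t. t \<le> T + 1 \<Longrightarrow> \<alpha> t \<le> A"
  shows "t \<le> T \<Longrightarrow> \<Phi> (t + 1) \<le> (\<theta> + \<gamma> * G)\<^sup>2 / 2 + A * R\<^sup>2 + (\<Sum>s=1..t. \<eta> / 2 * (\<epsilon> s)\<^sup>2)"
proof -
  have reset: "\<Phi> (t + 1) \<le> (\<theta> + \<gamma> * G)\<^sup>2 / 2 + A * R\<^sup>2" if "t \<le> T" "Q1 t \<le> \<theta>" for t
  proof -
    have "(Q1 (t + 1))\<^sup>2 \<le> (\<theta> + \<gamma> * G)\<^sup>2"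
      using Q1_step[of t] that Q1_nonneg by (intro power_mono) auto
    moreover have "\<alpha> (t + 1) * R\<^sup>2 \<le> A * R\<^sup>2"
      using A[of "t + 1"] that by (intro mult_right_mono) auto
    ultimately show ?thesis using potential_le[of "t + 1"] by simp
  qed
  show "t \<le> T \<Longrightarrow> \<Phi> (t + 1) \<le> (\<theta> + \<gamma> * G)\<^sup>2 / 2 + A * R\<^sup>2 + (\<Sum>s=1..t. \<eta> / 2 * (\<epsilon> s)\<^sup>2)"
  proof (induction t)
    case 0
    have "Q1 0 = 0" by (simp add: Q1_def init_Q)
    also have "0 \<le> \<theta>"
      unfolding \<theta>_def using \<gamma>_pos \<sigma>_pos \<rho>_pos G_nonneg F_nonneg by simp
    finally show ?case using reset[of 0] by simp
  next
    case (Suc t)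
    have nonneg: "0 \<le> (\<Sum>s=1..Suc t. \<eta> / 2 * (\<epsilon> s)\<^sup>2)"
      using \<eta>_pos by (intro sum_nonneg) auto
    show ?case
    proof (cases "Q1 (Suc t) \<le> \<theta>")
      case True
      then show ?thesis using reset[of "Suc t"] Suc.prems nonneg by simp
    next
      case False
      have "\<sigma> * \<gamma> * \<theta> \<le> \<sigma> * \<gamma> * Q1 (Suc t)"
        using False \<sigma>_pos \<gamma>_pos by (intro mult_left_mono) auto
      moreover have "\<sigma> * \<gamma> * (\<gamma> * G + Y / (\<sigma> * \<gamma>)) = \<sigma> * \<gamma>\<^sup>2 * G + Y" for Y
        using \<sigma>_pos \<gamma>_pos by (simp add: power2_eq_square field_simps)
      then have "\<sigma> * \<gamma> * \<theta> = \<sigma> * \<gamma>\<^sup>2 * G + F * (1 + R\<^sup>2 / \<rho>)"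
        unfolding \<theta>_def .
      ultimately have "\<Phi> (Suc t + 1) \<le> \<Phi> (t + 1) + \<eta> / 2 * (\<epsilon> (Suc t))\<^sup>2"
        using potential_step[of "Suc t"] by simp
      then show ?thesis using Suc by simp
    qed
  qed
qed

lemma \<alpha>_le:
  assumes "\<And>s. 1 \<le> s \<Longrightarrow> s \<le> n \<Longrightarrow> Q1 s \<le> B" "0 \<le> B" "t \<le> n"
  shows "\<alpha> t \<le> 2 / \<rho> * (\<gamma>\<^sup>2 * (2 * Lg * G + Lf\<^sup>2 + 1 + H\<^sup>2) + \<gamma> * Lg * B)"
  using assms(3)
proof (induction t)
  case 0
  then show ?case
    using \<rho>_pos \<gamma>_pos Lg_nonneg G_nonneg assms(2) by (simp add: \<alpha>_0)
next
  case (Suc t)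
  have "\<eta> \<le> \<gamma>\<^sup>2" using \<eta>_le_1 one_le_power[OF \<gamma>_ge_1, of 2] by linarith
  then have "\<eta> * Lf\<^sup>2 \<le> \<gamma>\<^sup>2 * Lf\<^sup>2" by (intro mult_right_mono) auto
  moreover have "\<gamma> * Lg * Q1 (Suc t) \<le> \<gamma> * Lg * B"
    using assms(1)[of "Suc t"] Suc.prems \<gamma>_pos Lg_nonneg by (intro mult_left_mono) auto
  ultimately have "\<gamma>\<^sup>2 * Lg * G + \<eta> * Lf\<^sup>2 + inverse \<eta> + (\<gamma> * Lg * Q1 (Suc t) + \<gamma>\<^sup>2 * (Lg * G + H\<^sup>2))
      \<le> \<gamma>\<^sup>2 * (2 * Lg * G + Lf\<^sup>2 + 1 + H\<^sup>2) + \<gamma> * Lg * B"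
    unfolding inverse_\<eta> by (simp add: algebra_simps)
  then have "2 / \<rho> * (\<gamma>\<^sup>2 * Lg * G + \<eta> * Lf\<^sup>2 + inverse \<eta> + (\<gamma> * Lg * Q1 (Suc t) + \<gamma>\<^sup>2 * (Lg * G + H\<^sup>2)))
      \<le> 2 / \<rho> * (\<gamma>\<^sup>2 * (2 * Lg * G + Lf\<^sup>2 + 1 + H\<^sup>2) + \<gamma> * Lg * B)"
    using \<rho>_pos by (intro mult_left_mono) auto
  then show ?case using Suc \<alpha>_step[of "Suc t"] by (simp add: Q1_def)
qed

text \<open>
  The bound from the potential is applied in the round \<open>r\<close> in which the dual vector is longest. Its
  length \<open>\<gamma> * m\<close> then controls the step sizes of all rounds, so the bound becomes a quadratic
  inequality for \<open>m\<close> alone.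
\<close>

lemma Q_le:
  assumes t: "1 \<le> t" "t \<le> T + 1" and k: "k \<in> {1..K}"
  shows "Q t k \<le> \<gamma> * ((2 * G + F * (1 + R\<^sup>2 / \<rho>) / \<sigma>)
      + (8 * R\<^sup>2 / \<rho> * (2 * Lg * G + Lf\<^sup>2 + 1 + H\<^sup>2) + 1 + G\<^sup>2) + 8 * R\<^sup>2 / \<rho> * Lg * real K)"
proof -
  define C where "C = 2 * Lg * G + Lf\<^sup>2 + 1 + H\<^sup>2"
  have C: "0 \<le> C" unfolding C_def using Lg_nonneg G_nonneg by simp
  have "finite (Q2 ` {1..T + 1})" "Q2 ` {1..T + 1} \<noteq> {}" by auto
  from Max_in[OF this] obtain r where r: "r \<in> {1..T + 1}" "Q2 r = Max (Q2 ` {1..T + 1})"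
    by (metis imageE)
  have max: "Q2 s \<le> Q2 r" if "s \<in> {1..T + 1}" for s
    unfolding r(2) using that by (intro Max_ge) auto
  define m where "m = sqrt (Q2 r) / \<gamma>"
  have Q2r: "0 \<le> Q2 r" unfolding Q2_def by (intro sum_nonneg) auto
  have m: "0 \<le> m" "Q2 r = \<gamma>\<^sup>2 * m\<^sup>2"
    using Q2r \<gamma>_pos by (simp_all add: m_def power_divide)
  have Q: "Q s j \<le> \<gamma> * m" if "s \<in> {1..T + 1}" "j \<in> {1..K}" for s j
  proof -
    have "(Q s j)\<^sup>2 \<le> Q2 s"
      unfolding Q2_def using that(2) by (intro member_le_sum) auto
    also have "\<dots> \<le> (\<gamma> * m)\<^sup>2" using max[OF that(1)] m(2) by (simp add: power_mult_distrib)
    finally show ?thesis by (rule power2_le_imp_le) (use m(1) \<gamma>_pos in auto)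
  qed
  have Q1_le: "Q1 s \<le> real K * (\<gamma> * m)" if "1 \<le> s" "s \<le> T + 1" for s
    using sum_bounded_above[of "{1..K}" "Q s" "\<gamma> * m"] Q that by (simp add: Q1_eq)
  \<comment> \<open>A common bound for all step sizes, linear in \<open>m\<close>.\<close>
  define A where "A = 2 / \<rho> * (\<gamma>\<^sup>2 * C + \<gamma> * Lg * (real K * (\<gamma> * m)))"
  have A: "\<alpha> s \<le> A" if "s \<le> T + 1" for s
    unfolding A_def C_def using \<alpha>_le[of "T + 1" "real K * (\<gamma> * m)", OF Q1_le] that m(1) \<gamma>_pos by simp
  have r': "1 \<le> r" "r \<le> T + 1" "r - 1 \<le> T" "r - 1 + 1 = r" using r(1) by auto
  have "(\<Sum>s=1..r - 1. \<eta> / 2 * (\<epsilon> s)\<^sup>2) \<le> (\<Sum>s=1..T. \<eta> / 2 * (\<epsilon> s)\<^sup>2)"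
    using r' \<eta>_pos by (intro sum_mono2) auto
  then have "\<Phi> r \<le> (\<theta> + \<gamma> * G)\<^sup>2 / 2 + A * R\<^sup>2 + \<gamma>\<^sup>2 / 2"
    using potential_bound[OF A, of "r - 1"] r' sum_gradient_error by simp
  moreover have "\<alpha> r * R\<^sup>2 \<le> A * R\<^sup>2" using A r' by (intro mult_right_mono) auto
  ultimately have bound: "Q2 r \<le> (\<theta> + \<gamma> * G)\<^sup>2 + 4 * A * R\<^sup>2 + \<gamma>\<^sup>2 + \<gamma>\<^sup>2 * G\<^sup>2"
    using Q2_le_potential[OF r'(1)] by simp
  define S where "S = F * (1 + R\<^sup>2 / \<rho>) / \<sigma>"
  have S: "0 \<le> S" unfolding S_def using F_nonneg \<rho>_pos \<sigma>_pos by simp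
  \<comment> \<open>The summand of \<open>\<theta>\<close> of order \<open>1 / \<gamma>\<close> is coarsened, to make the bound homogeneous in \<open>\<gamma>\<close>.\<close>
  have "S / \<gamma> \<le> S * \<gamma>"
  proof -
    have "S * 1 \<le> S * (\<gamma> * \<gamma>)" 
      using one_le_power[OF \<gamma>_ge_1, of 2] S by (intro mult_left_mono) (auto simp: power2_eq_square)
    then show ?thesis using \<gamma>_pos by (simp add: field_simps)
  qed
  then have "\<theta> + \<gamma> * G \<le> \<gamma> * (2 * G + S)"
    unfolding \<theta>_def S_def by (simp add: algebra_simps)
  moreover have "0 \<le> \<theta> + \<gamma> * G"
    unfolding \<theta>_def using \<gamma>_pos \<sigma>_pos \<rho>_pos G_nonneg F_nonneg by simp
  ultimately have "(\<theta> + \<gamma> * G)\<^sup>2 \<le> (\<gamma> * (2 * G + S))\<^sup>2"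
    by (intro power_mono)
  with bound have "\<gamma>\<^sup>2 * m\<^sup>2 \<le> (\<gamma> * (2 * G + S))\<^sup>2 + 4 * A * R\<^sup>2 + \<gamma>\<^sup>2 + \<gamma>\<^sup>2 * G\<^sup>2"
    unfolding m(2) by simp
  also have "\<dots> = \<gamma>\<^sup>2 * ((2 * G + S)\<^sup>2 + (8 * R\<^sup>2 / \<rho> * C + 1 + G\<^sup>2) + 8 * R\<^sup>2 / \<rho> * Lg * real K * m)"
    unfolding A_def power_mult_distrib[of \<gamma>]
    by (simp add: power2_eq_square[of \<gamma>] algebra_simps add_divide_distrib)
  finally have "m\<^sup>2 \<le> (2 * G + S)\<^sup>2 + (8 * R\<^sup>2 / \<rho> * C + 1 + G\<^sup>2) + 8 * R\<^sup>2 / \<rho> * Lg * real K * m"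
    using \<gamma>_pos by simp
  then have "m \<le> (2 * G + S) + (8 * R\<^sup>2 / \<rho> * C + 1 + G\<^sup>2) + 8 * R\<^sup>2 / \<rho> * Lg * real K"
    by (rule le_of_square_le_linear) (use G_nonneg S C \<rho>_pos Lg_nonneg in auto)
  then have "\<gamma> * m \<le> \<gamma> * ((2 * G + S) + (8 * R\<^sup>2 / \<rho> * C + 1 + G\<^sup>2) + 8 * R\<^sup>2 / \<rho> * Lg * real K)"
    using \<gamma>_pos by (intro mult_left_mono) auto
  moreover have "Q t k \<le> \<gamma> * m" using Q t k by simp
  ultimately show ?thesis unfolding S_def C_def by linarith
qed

lemma violation_le_Q:
  assumes k: "k \<in> {1..K}"
  shows "\<gamma> * violation g x n k \<le> Q (n + 1) k"
proof (induction n)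
  case 0
  then show ?case using Q_nonneg[OF k] by (simp add: violation_def)
next
  case (Suc n)
  have "Q (Suc n) k + \<gamma> * g k (x (Suc n)) \<le> Q (Suc n + 1) k"
    using step_Q[of "Suc n + 1" k] k by simp
  with Suc show ?case by (simp add: violation_def distrib_left)
qed

lemma violation_bound:
  assumes k: "k \<in> {1..K}"
  shows "violation g x T k \<le> (2 * G + F * (1 + R\<^sup>2 / \<rho>) + 8 * R\<^sup>2 / \<rho> * (2 * Lg * G + Lf\<^sup>2 + 1 + H\<^sup>2)
     + 1 + G\<^sup>2 + 8 * R\<^sup>2 / \<rho> * Lg * real K) * (1 + inverse \<sigma>)"
proof -
  define a where "a = F * (1 + R\<^sup>2 / \<rho>)"
  define b where "b = 2 * G + (8 * R\<^sup>2 / \<rho> * (2 * Lg * G + Lf\<^sup>2 + 1 + H\<^sup>2) + 1 + G\<^sup>2) + 8 * R\<^sup>2 / \<rho> * Lg * real K"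
  have nonneg: "0 \<le> a" "0 \<le> b"
    unfolding a_def b_def using F_nonneg G_nonneg Lg_nonneg \<rho>_pos by simp_all
  have "\<gamma> * violation g x T k \<le> \<gamma> * (b + a / \<sigma>)"
    using order_trans[OF violation_le_Q[OF k, of T] Q_le[of "T + 1" k]] k
    unfolding a_def b_def by (simp add: algebra_simps)
  then have "violation g x T k \<le> b + a * inverse \<sigma>"
    using \<gamma>_pos by (simp add: divide_inverse)
  also have "\<dots> \<le> (a + b) * (1 + inverse \<sigma>)"
    using nonneg \<sigma>_pos by (simp add: algebra_simps)
  finally show ?thesis unfolding a_def b_def by (simp add: algebra_simps)
qed

end

section \<open>The bound as a polynomial\<close>

lemma mpoly_eval_superset:
  assumes "finite S" "Poly_Mapping.keys P \<subseteq> S"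
  shows "mpoly_eval P vs =
    (\<Sum>m\<in>S. Poly_Mapping.lookup P m * (\<Prod>i<length vs. (vs ! i) ^ Poly_Mapping.lookup m i))"
  unfolding mpoly_eval_def using assms
  by (intro sum.mono_neutral_left) (auto simp: in_keys_iff)

lemma mpoly_eval_add: "mpoly_eval (P + P') vs = mpoly_eval P vs + mpoly_eval P' vs"
proof -
  let ?S = "Poly_Mapping.keys P \<union> Poly_Mapping.keys P'"
  have "mpoly_eval p vs = (\<Sum>m\<in>?S. Poly_Mapping.lookup p m
      * (\<Prod>i<length vs. (vs ! i) ^ Poly_Mapping.lookup m i))" if "p \<in> {P, P', P + P'}" for p
    using that keys_add[of P P'] by (intro mpoly_eval_superset) auto
  then show ?thesis by (simp add: lookup_add distrib_right sum.distrib)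
qed

text \<open>
  Evaluation is additive, so a polynomial can be assembled from its monomials one by one.
\<close>

lemma nonneg_mpoly_from_monomials:
  assumes "\<forall>(c, es)\<in>set ms. 0 \<le> c \<and> length es = n"
  shows "\<exists>P. nonneg_mpoly_in n P \<and> (\<forall>vs. length vs = n \<longrightarrow>
    mpoly_eval P vs = (\<Sum>(c, es)\<leftarrow>ms. c * (\<Prod>i<n. (vs ! i) ^ (es ! i))))"
  using assms
proof (induction ms)
  case Nil
  show ?case by (intro exI[of _ 0]) (simp add: nonneg_mpoly_in_def mpoly_eval_def)
next
  case (Cons a ms)
  obtain c es where a: "a = (c, es)" by (cases a)
  have c: "0 \<le> c" and es: "length es = n" using Cons.prems a by auto
  obtain P where P: "nonneg_mpoly_in n P" "\<And>vs. length vs = n \<Longrightarrow>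
      mpoly_eval P vs = (\<Sum>(c, es)\<leftarrow>ms. c * (\<Prod>i<n. (vs ! i) ^ (es ! i)))"
    using Cons by auto
  define m where "m = Poly_Mapping.nth es"
  have m: "Poly_Mapping.lookup m i = es ! i" if "i < n" for i
    using that es by (simp add: m_def nth_default_nth)
  have keys_m: "Poly_Mapping.keys m \<subseteq> {..<n}"
  proof
    fix i assume "i \<in> Poly_Mapping.keys m"
    then have "nth_default 0 es i \<noteq> 0" by (simp only: in_keys_iff m_def lookup_nth) simp
    then show "i \<in> {..<n}" using es by (simp add: nth_default_def split: if_splits)
  qed
  let ?P = "Poly_Mapping.single m c + P"
  have "nonneg_mpoly_in n ?P"
    unfolding nonneg_mpoly_in_def
  proof
    fix k assume "k \<in> Poly_Mapping.keys ?P"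
    then have "k = m \<or> k \<in> Poly_Mapping.keys P"
      using keys_add[of "Poly_Mapping.single m c" P] by (auto split: if_splits)
    moreover have "0 \<le> Poly_Mapping.lookup P k"
      using P(1) by (cases "k \<in> Poly_Mapping.keys P") (auto simp: nonneg_mpoly_in_def in_keys_iff)
    ultimately show "Poly_Mapping.keys k \<subseteq> {..<n} \<and> 0 \<le> Poly_Mapping.lookup ?P k"
      using P(1) keys_m c by (auto simp: nonneg_mpoly_in_def lookup_add lookup_single when_def)
  qed
  moreover have "mpoly_eval ?P vs = (\<Sum>(c, es)\<leftarrow>a # ms. c * (\<Prod>i<n. (vs ! i) ^ (es ! i)))"
    if "length vs = n" for vs
  proof -
    have "mpoly_eval (Poly_Mapping.single m c) vs = c * (\<Prod>i<n. (vs ! i) ^ (es ! i))"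
      by (subst mpoly_eval_superset[of "{m}"]) (auto simp: that m)
    then show ?thesis by (simp add: mpoly_eval_add P(2)[OF that] a)
  qed
  ultimately show ?case by blast
qed

lemma violation_polynomial:
  obtains P where "nonneg_mpoly_in 9 P"
    "\<And>R H F G Lf Lg \<kappa> \<rho> \<tau> :: real. mpoly_eval P [R, H, F, G, Lf, Lg, \<kappa>, \<rho>, \<tau>] =
       2 * G + F * (1 + R\<^sup>2 * \<tau>) + 8 * R\<^sup>2 * \<tau> * (2 * Lg * G + Lf\<^sup>2 + 1 + H\<^sup>2)
       + 1 + G\<^sup>2 + 8 * R\<^sup>2 * \<tau> * Lg * \<kappa>"
proof -
  let ?ms = "[(2,  [0, 0, 0, 1, 0, 0, 0, 0, 0]), (1,  [0, 0, 1, 0, 0, 0, 0, 0, 0]),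
              (1,  [2, 0, 1, 0, 0, 0, 0, 0, 1]), (16, [2, 0, 0, 1, 0, 1, 0, 0, 1]),
              (8,  [2, 0, 0, 0, 2, 0, 0, 0, 1]), (8,  [2, 0, 0, 0, 0, 0, 0, 0, 1]),
              (8,  [2, 2, 0, 0, 0, 0, 0, 0, 1]), (1,  [0, 0, 0, 0, 0, 0, 0, 0, 0]),
              (1,  [0, 0, 0, 2, 0, 0, 0, 0, 0]), (8,  [2, 0, 0, 0, 0, 1, 1, 0, 1])]
             :: (real \<times> nat list) list"
  obtain P where P: "nonneg_mpoly_in 9 P" "\<And>vs. length vs = 9 \<Longrightarrow>
      mpoly_eval P vs = (\<Sum>(c, es)\<leftarrow>?ms. c * (\<Prod>i<9. (vs ! i) ^ (es ! i)))"
    using nonneg_mpoly_from_monomials[of ?ms 9] by auto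
  have prod9: "(\<Prod>i<9. h i) = h 0 * h 1 * h 2 * h 3 * h 4 * h 5 * h 6 * h 7 * h 8"
    for h :: "nat \<Rightarrow> real"
    by (simp add: eval_nat_numeral)
  show thesis
    by (rule that[OF P(1)]) (subst P(2), simp, simp add: prod9 algebra_simps)
qed

theorem theorem4p3:
  "\<exists>P :: mpoly_real. nonneg_mpoly_in 9 P \<and>
    (\<forall>(d::nat) (K::nat) (N :: rvec \<Rightarrow> real) (X :: rvec set)
       (f :: nat \<Rightarrow> rvec \<Rightarrow> real) (gf :: nat \<Rightarrow> rvec \<Rightarrow> rvec)
       (g :: nat \<Rightarrow> rvec \<Rightarrow> real) (gg :: nat \<Rightarrow> rvec \<Rightarrow> rvec)
       (F::real) (Lf::real) (G::real) (Hk :: nat \<Rightarrow> real) (Lg::real) (H::real) (\<sigma>::real)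
       (\<omega> :: rvec \<Rightarrow> real) (g\<omega> :: rvec \<Rightarrow> rvec) (\<rho>::real) (R::real).
      bounded_online_problem d K N X f gf g gg F Lf G Hk Lg \<and>
      H = (\<Sum>k=1..K. Hk k) \<and>
      slater K X g \<sigma> \<and>
      mirror_map d N X \<omega> g\<omega> \<rho> \<and>
      0 \<le> R \<and> (\<forall>x\<in>X. \<forall>y\<in>X. bregman d \<omega> g\<omega> x y \<le> R\<^sup>2)
      \<longrightarrow>
      (\<forall>(T::nat) (\<eta>::real) (\<gamma>::real) (\<alpha> :: nat \<Rightarrow> real) (\<xi> :: nat \<Rightarrow> real)
         (x :: nat \<Rightarrow> rvec) (w :: nat \<Rightarrow> rvec) (Q :: nat \<Rightarrow> nat \<Rightarrow> real).
        1 \<le> T \<and>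
        \<eta> = (gradient_variation d N X gf T + Lf\<^sup>2 + 1) powr (- 1 / 2) \<and>
        \<gamma> = (gradient_variation d N X gf T + Lf\<^sup>2 + 1) powr (1 / 4) \<and>
        (\<forall>t\<ge>1. \<xi> t = \<gamma> * Lg * (\<Sum>k=1..K. \<bar>Q t k\<bar>) + \<gamma>\<^sup>2 * (Lg * G + H\<^sup>2)) \<and>
        \<alpha> 0 = 0 \<and>
        (\<forall>t\<ge>1. \<alpha> t =
           max (2 / \<rho> * (\<gamma>\<^sup>2 * Lg * G + \<eta> * Lf\<^sup>2 + inverse \<eta> + \<xi> t)) (\<alpha> (t - 1))) \<and>
        mirror_prox_run d K X gf g gg \<omega> g\<omega> \<gamma> \<alpha> x w Q
        \<longrightarrow>
        (\<forall>k\<in>{1..K}. violation g x T k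
            \<le> mpoly_eval P [R, H, F, G, Lf, Lg, real K, \<rho>, 1 / \<rho>] * (1 + inverse \<sigma>))))"
proof -
  obtain P where P: "nonneg_mpoly_in 9 P"
    "\<And>R H F G Lf Lg \<kappa> \<rho> \<tau> :: real. mpoly_eval P [R, H, F, G, Lf, Lg, \<kappa>, \<rho>, \<tau>] =
       2 * G + F * (1 + R\<^sup>2 * \<tau>) + 8 * R\<^sup>2 * \<tau> * (2 * Lg * G + Lf\<^sup>2 + 1 + H\<^sup>2)
       + 1 + G\<^sup>2 + 8 * R\<^sup>2 * \<tau> * Lg * \<kappa>"
    using violation_polynomial by blast
  show ?thesis
  proof (intro exI[of _ P] conjI P(1) allI impI ballI; elim conjE)
    fix d K :: nat and N :: "rvec \<Rightarrow> real" and X :: "rvec set"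
      and f :: "nat \<Rightarrow> rvec \<Rightarrow> real" and gf :: "nat \<Rightarrow> rvec \<Rightarrow> rvec"
      and g :: "nat \<Rightarrow> rvec \<Rightarrow> real" and gg :: "nat \<Rightarrow> rvec \<Rightarrow> rvec"
      and F Lf G :: real and Hk :: "nat \<Rightarrow> real" and Lg H \<sigma> :: real
      and \<omega> :: "rvec \<Rightarrow> real" and g\<omega> :: "rvec \<Rightarrow> rvec" and \<rho> R :: real
      and T :: nat and \<eta> \<gamma> :: real and \<alpha> \<xi> :: "nat \<Rightarrow> real"
      and x w :: "nat \<Rightarrow> rvec" and Q :: "nat \<Rightarrow> nat \<Rightarrow> real" and k :: nat
    assume problem: "bounded_online_problem d K N X f gf g gg F Lf G Hk Lg"
      and H: "H = (\<Sum>k=1..K. Hk k)" and slater: "slater K X g \<sigma>"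
      and mirror: "mirror_map d N X \<omega> g\<omega> \<rho>"
      and R: "\<forall>x\<in>X. \<forall>y\<in>X. bregman d \<omega> g\<omega> x y \<le> R\<^sup>2"
      and \<eta>: "\<eta> = (gradient_variation d N X gf T + Lf\<^sup>2 + 1) powr (- 1 / 2)"
      and \<gamma>: "\<gamma> = (gradient_variation d N X gf T + Lf\<^sup>2 + 1) powr (1 / 4)"
      and \<xi>: "\<forall>t\<ge>1. \<xi> t = \<gamma> * Lg * (\<Sum>k=1..K. \<bar>Q t k\<bar>) + \<gamma>\<^sup>2 * (Lg * G + H\<^sup>2)"
      and \<alpha>: "\<alpha> 0 = 0" "\<forall>t\<ge>1. \<alpha> t =
           max (2 / \<rho> * (\<gamma>\<^sup>2 * Lg * G + \<eta> * Lf\<^sup>2 + inverse \<eta> + \<xi> t)) (\<alpha> (t - 1))"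
      and run: "mirror_prox_run d K X gf g gg \<omega> g\<omega> \<gamma> \<alpha> x w Q"
      and k: "k \<in> {1..K}"
    obtain z where z: "0 < \<sigma>" "z \<in> X" "\<And>k. k \<in> {1..K} \<Longrightarrow> g k z \<le> - \<sigma>"
      using slater by (auto simp: slater_def)
    interpret bounded_online_problem d K N X f gf g gg F Lf G Hk Lg by (rule problem)
    let ?V = "gradient_variation d N X gf T"
    define S where "S = ?V + Lf\<^sup>2 + 1"
    have V: "0 \<le> ?V" by (rule gradient_variation_nonneg)
    then have S: "1 \<le> S" by (simp add: S_def)
    have \<gamma>S: "\<gamma> = S powr (1 / 4)" and \<eta>S: "\<eta> = S powr (- (1 / 2))"
      using \<gamma> \<eta> by (simp_all add: S_def)
    have \<gamma>2: "\<gamma>\<^sup>2 = S powr (1 / 2)"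
      using S by (simp add: \<gamma>S power2_eq_square flip: powr_add)
    have \<eta>_inv: "\<eta> = inverse (\<gamma>\<^sup>2)"
      unfolding \<gamma>2 \<eta>S by (rule powr_minus)
    have "\<eta> * ?V \<le> \<eta> * S"
      using S \<eta>S by (intro mult_left_mono) (auto simp: S_def)
    also have "\<dots> = S powr (- (1 / 2)) * S powr 1" using S by (simp add: \<eta>S)
    also have "\<dots> = \<gamma>\<^sup>2" unfolding \<gamma>2 powr_add[symmetric] by simp
    finally have variation: "\<eta> * ?V \<le> \<gamma>\<^sup>2" .
    interpret mirror_prox_analysis d K N X f gf g gg F Lf G Hk Lg \<omega> g\<omega> \<rho> \<gamma> \<alpha> x w Q H \<sigma> R \<eta> T z
    proof (intro mirror_prox_analysis.intro mirror_prox_analysis_axioms.intro problem mirror run)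
      show "1 \<le> \<gamma>" using S by (simp add: \<gamma>S ge_one_powr_ge_zero)
      show "\<alpha> t = max (2 / \<rho> * (\<gamma>\<^sup>2 * Lg * G + \<eta> * Lf\<^sup>2 + inverse \<eta> +
          (\<gamma> * Lg * (\<Sum>k=1..K. \<bar>Q t k\<bar>) + \<gamma>\<^sup>2 * (Lg * G + H\<^sup>2)))) (\<alpha> (t - 1))" if "1 \<le> t" for t
        using \<alpha>(2) \<xi> that by simp
    qed (use H z R \<eta>_inv variation \<alpha> in auto)
    show "violation g x T k
        \<le> mpoly_eval P [R, H, F, G, Lf, Lg, real K, \<rho>, 1 / \<rho>] * (1 + inverse \<sigma>)"
      using violation_bound[OF k] by (simp add: P(2))
  qed
qed

end
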